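(* Let $T=\{1243,2341,4123\}$ and let $F_T(x)=\sum_{n\ge0}|S_n(T)|x^n$. Then $$F_T(x)=\frac{1-9x+34x^2-70x^3+87x^4-65x^5+26x^6-5x^7}{(1-x)^7(1-2x)}+\frac{1}{1-x}\big(C(x)-1\big),$$ where $C(x)=\frac{1-\sqrt{1-4x}}{2x}$.
   Context: $S_n$ is the set of permutations of $[n]$ ($S_0$ contains the empty permutation). A permutation avoids a pattern $\tau$ if it has no subsequence order-isomorphic to $\tau$; $S_n(T)$ is the set of permutations in $S_n$ avoiding every pattern in $T$. $C(x)=\frac{1-\sqrt{1-4x}}{2x}=\sum_{n\ge0}\frac{1}{n+1}\binom{2n}{n}x^n$ is the Catalan generating function. *)

theory Defs
  imports
    "HOL-Combinatorics.Multiset_Permutations"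
    "HOL-Library.Sublist"
    "HOL-Computational_Algebra.Formal_Power_Series"
begin

text \<open>Permutations of \<open>[n]\<close> are written in one-line notation, as the elements of
  \<^term>\<open>permutations_of_set {1..n}\<close>; for \<open>n = 0\<close> this set is \<open>{[]}\<close>.\<close>

definition order_isomorphic :: "nat list \<Rightarrow> nat list \<Rightarrow> bool" where
  "order_isomorphic xs ys \<longleftrightarrow> length xs = length ys \<and>
     (\<forall>i < length xs. \<forall>j < length xs. xs ! i < xs ! j \<longleftrightarrow> ys ! i < ys ! j)"

definition avoids :: "nat list \<Rightarrow> nat list \<Rightarrow> bool" where
  "avoids p \<tau> \<longleftrightarrow> \<not> (\<exists>s. subseq s p \<and> order_isomorphic s \<tau>)"

definition avoiding_perms :: "nat \<Rightarrow> nat list set \<Rightarrow> nat list set" where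
  "avoiding_perms n T = {p \<in> permutations_of_set {1..n}. \<forall>\<tau>\<in>T. avoids p \<tau>}"

definition avoidance_gf :: "nat list set \<Rightarrow> real fps" where
  "avoidance_gf T = Abs_fps (\<lambda>n. real (card (avoiding_perms n T)))"

text \<open>The square root is the formal one with constant coefficient \<open>root 2 1 = 1\<close>.
  Hence the numerator has constant coefficient \<open>0\<close>, and the division by \<open>2x\<close>
  (which shifts coefficients) is exact.\<close>

definition catalan_gf :: "real fps" where
  "catalan_gf = (1 - fps_radical root 2 (1 - 4 * fps_X)) / (2 * fps_X)"

lemma gbinomial_half_catalan:
  "((1/2 :: real) gchoose Suc n) * (-4) ^ Suc n = - 2 * (real ((2 * n) choose n) / real (n + 1))"
proof (induction n)
  case 0
  show ?case by simp
next
  case (Suc n)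
  have g: "((1/2 :: real) gchoose Suc (Suc n)) * real (n + 2)
             = (1/2 - real (Suc n)) * ((1/2) gchoose Suc n)"
    using gbinomial_mult_1[of "1/2 :: real" "Suc n"] by (simp add: algebra_simps)
  have c: "real ((2 * Suc n) choose Suc n) * real (n + 1) = 2 * (2 * real n + 1) * real ((2 * n) choose n)"
  proof -
    have a: "Suc n * ((2 * Suc n) choose Suc n) = 2 * Suc n * (Suc (2 * n) choose n)"
      using Suc_times_binomial_eq[of "Suc (2 * n)" n] by (simp add: algebra_simps)
    have b: "(Suc (2 * n) choose n) * Suc n = Suc (2 * n) * ((2 * n) choose n)"
      using Suc_times_binomial_eq[of "2 * n" n] binomial_symmetric[of n "Suc (2 * n)"]
      by (simp add: Suc_diff_le algebra_simps)
    have "((2 * Suc n) choose Suc n) = 2 * (Suc (2 * n) choose n)"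
      using a by (metis (no_types, lifting) mult.assoc mult.left_commute mult_cancel1 nat.distinct(1))
    then have "((2 * Suc n) choose Suc n) * Suc n = 2 * (Suc (2 * n) * ((2 * n) choose n))"
      using b by (metis mult.assoc)
    then have "real (((2 * Suc n) choose Suc n) * Suc n) = real (2 * (Suc (2 * n) * ((2 * n) choose n)))"
      by (rule arg_cong)
    then show ?thesis unfolding of_nat_mult by (simp add: algebra_simps)
  qed
  have "((1/2 :: real) gchoose Suc (Suc n)) * (-4) ^ Suc (Suc n) * real (n + 2)
      = (((1/2 :: real) gchoose Suc (Suc n)) * real (n + 2)) * ((-4) * (-4) ^ Suc n)"
    by simp
  also have "\<dots> = (4 * real n + 2) * (((1/2) gchoose Suc n) * (-4) ^ Suc n)"
    unfolding g by (simp add: algebra_simps)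
  also have "\<dots> = - 2 * (2 * (2 * real n + 1) * real ((2 * n) choose n) / real (n + 1))"
    unfolding Suc.IH by (simp add: field_simps)
  also have "\<dots> = - 2 * real ((2 * Suc n) choose Suc n)"
    unfolding c[symmetric] by simp
  finally show ?case by (simp add: field_simps)
qed

lemma fps_sqrt_catalan:
  "fps_radical root 2 (1 - 4 * fps_X :: real fps) = Abs_fps (\<lambda>n. ((1/2) gchoose n) * (-4) ^ n)"
proof -
  let ?b = "fps_compose (fps_binomial (1/2)) (fps_const (-4) * fps_X) :: real fps"
  have b: "?b = Abs_fps (\<lambda>n. ((1/2) gchoose n) * (-4) ^ n)"
    by (simp add: fps_compose_linear) (simp add: mult.commute)
  have "?b ^ 2 = fps_compose (fps_binomial (1/2) ^ 2) (fps_const (-4) * fps_X)"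
    by (rule fps_compose_power) simp
  also have "\<dots> = 1 - 4 * fps_X"
    by (simp add: fps_binomial_power fps_binomial_1 fps_compose_add_distrib numeral_fps_const
      flip: fps_const_neg)
  finally have "?b ^ Suc 1 = 1 - 4 * fps_X" by (simp add: numeral_2_eq_2)
  then show ?thesis
    using radical_unique[of root 1 "1 - 4 * fps_X :: real fps" ?b] b
    by (simp add: numeral_2_eq_2)
qed

lemma catalan_gf_nth: "fps_nth catalan_gf n = real ((2 * n) choose n) / real (n + 1)"
proof -
  let ?C = "Abs_fps (\<lambda>n. real ((2 * n) choose n) / real (n + 1))"
  have "1 - fps_radical root 2 (1 - 4 * fps_X) = ?C * (2 * fps_X)"
  proof (rule fps_ext)
    fix m
    show "fps_nth (1 - fps_radical root 2 (1 - 4 * fps_X)) m = fps_nth (?C * (2 * fps_X)) m"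
    proof (cases m)
      case 0
      then show ?thesis by simp
    next
      case (Suc k)
      have "?C * (2 * fps_X) = fps_const 2 * (?C * fps_X)"
        by (simp only: numeral_fps_const mult.left_commute)
      then have "fps_nth (?C * (2 * fps_X)) (Suc k) = 2 * (real ((2 * k) choose k) / real (k + 1))"
        by (simp only: fps_mult_left_const_nth) simp
      then show ?thesis
        unfolding fps_sqrt_catalan Suc using gbinomial_half_catalan[of k] by simp
    qed
  qed
  then have C: "catalan_gf = ?C"
    unfolding catalan_gf_def by simp
  show ?thesis unfolding C by simp
qed

end

theory Submission
  imports Defs
begin

text \<open>Splitting off the empty permutation and the permutations ending in their maximum gives
  \<open>F = 1 + x F + (C - 1 - x/(1-x)) + A + B\<close>. The bracket counts the 123-avoiders whose
  maximum is not last: a 123-avoider with its maximum at the end is a decreasing list followed by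
  that maximum, which accounts for \<open>x/(1-x)\<close>. \<open>A\<close> and \<open>B\<close>
  count the two remaining cases. Solving for \<open>F\<close> yields one factor
  \<open>1/(1-x)\<close>. The other six come from the second case with \<open>Y\<close> decreasing
  and nonempty, where four numbers (the sizes of \<open>A\<close>, of the part of \<open>L\<close>
  below \<open>Y\<close>, of \<open>Y\<close> and of \<open>D\<close>) and the lengths of the two
  runs of a word are free. The factor \<open>1/(1-2x)\<close> comes from arbitrary binary words and
  from the avoiders of 123 and 132. The 123-avoiders have to be removed from the second case only,
  because an ascent of \<open>L\<close> followed by the maximum is already a 123. The main burden is
  uniqueness: every permutation must determine its parameters, including the degenerate cases with
  an empty block.\<close>

text \<open>Let a permutation in the class be \<open>L n R\<close> with maximum \<open>n\<close>. If \<open>R\<close> is empty, then \<open>L\<close> is an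
  arbitrary member of the class, which accounts for a factor \<open>1/(1-x)\<close>. All patterns contain 123,
  so the 123-avoiders belong to the class; they are counted by the Catalan numbers, which gives
  the non-rational term. For the remaining permutations there are two cases.

  If \<open>L\<close> has an ascent, then the avoidance of 1243 and 2341 forces every ascent of \<open>L\<close> to straddle
  all values of \<open>R\<close>. Hence \<open>L\<close> is a merge of two decreasing sequences, one below and one above \<open>R\<close>,
  and \<open>R\<close> avoids 123 and 132; if some large entry of \<open>L\<close> precedes a small one,
  then \<open>R\<close> is even decreasing.

  If \<open>L\<close> is decreasing with last entry \<open>m\<close>, then \<open>R\<close> has an ascent above \<open>m\<close>. Cutting \<open>R\<close> at the top
  of the first such ascent determines its shape: a decreasing sequence, then this top, then
  a sequence of values that are smaller than every other entry of \<open>R\<close> above \<open>m\<close>.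

  Both cases are parametrised by words and a few integers, so their generating functions
  are rational.\<close>

section \<open>Generating functions of weighted sets\<close>

text \<open>Finiteness of the level sets is demanded because \<open>card\<close> is \<open>0\<close>
  on infinite sets, which would spoil the rules for unions and products.\<close>

definition has_gf :: "'a set \<Rightarrow> ('a \<Rightarrow> nat) \<Rightarrow> real fps \<Rightarrow> bool" where
  "has_gf S sz f \<longleftrightarrow> (\<forall>n. finite {x \<in> S. sz x = n} \<and> real (card {x \<in> S. sz x = n}) = fps_nth f n)"

lemma has_gf_unique: "has_gf S sz f \<Longrightarrow> has_gf S sz g \<Longrightarrow> f = g"
  unfolding has_gf_def by (metis fps_ext)

lemma has_gf_Un:
  assumes "has_gf A sz f" "has_gf B sz g" "A \<inter> B = {}"
  shows "has_gf (A \<union> B) sz (f + g)"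
  unfolding has_gf_def
proof
  fix n
  have e: "{x \<in> A \<union> B. sz x = n} = {x \<in> A. sz x = n} \<union> {x \<in> B. sz x = n}" by auto
  show "finite {x \<in> A \<union> B. sz x = n} \<and> real (card {x \<in> A \<union> B. sz x = n}) = fps_nth (f + g) n"
    using assms unfolding e has_gf_def by (subst card_Un_disjoint) auto
qed

lemma has_gf_Diff:
  assumes "has_gf A sz f" "has_gf B sz g" "B \<subseteq> A"
  shows "has_gf (A - B) sz (f - g)"
  unfolding has_gf_def
proof
  fix n
  have e: "{x \<in> A - B. sz x = n} = {x \<in> A. sz x = n} - {x \<in> B. sz x = n}" by auto
  have s: "{x \<in> B. sz x = n} \<subseteq> {x \<in> A. sz x = n}" using assms by auto
  have "card {x \<in> B. sz x = n} \<le> card {x \<in> A. sz x = n}"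
    using assms s unfolding has_gf_def by (intro card_mono) auto
  then show "finite {x \<in> A - B. sz x = n} \<and> real (card {x \<in> A - B. sz x = n}) = fps_nth (f - g) n"
    using assms s unfolding e has_gf_def by (subst card_Diff_subset) (auto simp: of_nat_diff)
qed

lemma has_gf_times:
  assumes "has_gf A s f" "has_gf B t g"
  shows "has_gf (A \<times> B) (\<lambda>(a, b). s a + t b) (f * g)"
  unfolding has_gf_def
proof
  fix n
  let ?A = "\<lambda>k. {x \<in> A. s x = k}" and ?B = "\<lambda>k. {x \<in> B. t x = k}"
  have e: "{x \<in> A \<times> B. (case x of (a, b) \<Rightarrow> s a + t b) = n} = (\<Union>k\<in>{0..n}. ?A k \<times> ?B (n - k))"
    by auto
  have fin: "finite (?A k)" "finite (?B k)" for k using assms unfolding has_gf_def by auto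
  have "card (\<Union>k\<in>{0..n}. ?A k \<times> ?B (n - k)) = (\<Sum>k=0..n. card (?A k \<times> ?B (n - k)))"
    using fin by (intro card_UN_disjoint) auto
  also have "real \<dots> = fps_nth (f * g) n"
    using assms unfolding fps_mult_nth has_gf_def by (simp add: card_cartesian_product)
  finally show "finite {x \<in> A \<times> B. (case x of (a, b) \<Rightarrow> s a + t b) = n} \<and>
      real (card {x \<in> A \<times> B. (case x of (a, b) \<Rightarrow> s a + t b) = n}) = fps_nth (f * g) n"
    unfolding e using fin by auto
qed

text \<open>This transports a series along an injective parametrisation; \<open>c\<close> counts the
  entries that are present for every choice of parameters.\<close>

lemma has_gf_image:
  assumes "has_gf A s f" "inj_on h A" "\<And>x. x \<in> A \<Longrightarrow> t (h x) = s x + c"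
  shows "has_gf (h ` A) t (fps_X ^ c * f)"
  unfolding has_gf_def
proof
  fix n
  show "finite {x \<in> h ` A. t x = n} \<and> real (card {x \<in> h ` A. t x = n}) = fps_nth (fps_X ^ c * f) n"
  proof (cases "n < c")
    case True
    then have "{x \<in> h ` A. t x = n} = {}" using assms(3) by auto
    then show ?thesis using True by (simp add: fps_X_power_mult_nth del: Collect_empty_eq)
  next
    case False
    have e: "{x \<in> h ` A. t x = n} = h ` {x \<in> A. s x = n - c}"
      using False assms(3) by auto
    have "inj_on h {x \<in> A. s x = n - c}" using assms(2) by (rule inj_on_subset) auto
    then show ?thesis using False assms(1) unfolding e has_gf_def
      by (simp add: fps_X_power_mult_nth card_image)
  qed
qed

lemma has_gf_singleton: "has_gf {x} s (fps_X ^ s x)"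
  unfolding has_gf_def by (auto simp: fps_X_power_nth intro: finite_subset[of _ "{x}"])
   (metis (mono_tags, lifting) Collect_cong One_nat_def card_1_singleton_iff singleton_conv)

section \<open>Series of the natural numbers and of binary words\<close>

lemma inverse_one_minus_X: "(1 - fps_X) * inverse (1 - fps_X :: real fps) = 1"
  by (rule inverse_mult_eq_1') simp

lemma inverse_one_minus_2X: "(1 - 2 * fps_X) * inverse (1 - 2 * fps_X :: real fps) = 1"
  by (rule inverse_mult_eq_1') (simp add: numeral_fps_const)

lemma has_gf_nat: "has_gf (UNIV :: nat set) (\<lambda>k. k) (inverse (1 - fps_X))"
proof -
  have "inverse (1 - fps_X :: real fps) = Abs_fps (\<lambda>_. 1)"
    by (rule fps_inverse_gp'[symmetric, THEN arg_cong[where f=inverse], simplified])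
  then show ?thesis unfolding has_gf_def by auto
qed

lemma has_gf_words: "has_gf (UNIV :: bool list set) length (inverse (1 - 2 * fps_X))"
proof -
  have "(1 - 2 * fps_X) * Abs_fps (\<lambda>n. 2 ^ n :: real) = 1"
  proof (rule fps_ext)
    fix n
    show "fps_nth ((1 - 2 * fps_X) * Abs_fps (\<lambda>n. 2 ^ n :: real)) n = fps_nth 1 n"
      by (cases n) (simp_all add: left_diff_distrib numeral_fps_const mult.assoc)
  qed
  then have "Abs_fps (\<lambda>n. 2 ^ n) = inverse (1 - 2 * fps_X :: real fps)"
    by (rule fps_inverse_unique[symmetric])
  then have "fps_nth (inverse (1 - 2 * fps_X :: real fps)) n = 2 ^ n" for n
    by (metis fps_nth_Abs_fps)
  moreover have "finite {w :: bool list. length w = n}" "card {w :: bool list. length w = n} = 2 ^ n" for n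
    using finite_lists_length_eq[of "UNIV :: bool set" n] card_lists_length_eq[of "UNIV :: bool set" n] by auto
  ultimately show ?thesis unfolding has_gf_def by auto
qed

section \<open>Pattern avoidance as a recursive condition\<close>

abbreviation dec :: "nat list \<Rightarrow> bool" where
  "dec \<equiv> sorted_wrt (>)"

text \<open>The recursion fixes the first entry of an occurrence and leaves a condition on the tail
  with one argument less. \<open>subseq_no3\<close> and \<open>subseq_no4\<close> translate it to
  subsequences, the form in which most arguments run.\<close>

fun no3 :: "('a \<Rightarrow> 'a \<Rightarrow> 'a \<Rightarrow> bool) \<Rightarrow> 'a list \<Rightarrow> bool" where
  "no3 P [] \<longleftrightarrow> True"
| "no3 P (x # xs) \<longleftrightarrow> sorted_wrt (\<lambda>b c. \<not> P x b c) xs \<and> no3 P xs"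

fun no4 :: "('a \<Rightarrow> 'a \<Rightarrow> 'a \<Rightarrow> 'a \<Rightarrow> bool) \<Rightarrow> 'a list \<Rightarrow> bool" where
  "no4 P [] \<longleftrightarrow> True"
| "no4 P (x # xs) \<longleftrightarrow> no3 (P x) xs \<and> no4 P xs"

lemma no3_append:
  "no3 P (xs @ ys) \<longleftrightarrow> no3 P xs \<and> no3 P ys \<and>
     (\<forall>x\<in>set xs. sorted_wrt (\<lambda>b c. \<not> P x b c) ys) \<and>
     (\<forall>y\<in>set ys. sorted_wrt (\<lambda>a b. \<not> P a b y) xs)"
  by (induction xs) (auto simp: sorted_wrt_append)

lemma subseq_Cons_Cons_iff:
  "subseq (a # as) (x # xs) \<longleftrightarrow> subseq (a # as) xs \<or> a = x \<and> subseq as xs"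
  by (cases "a = x") (auto dest: subseq_Cons')

lemma subseq_no2:
  "sorted_wrt (\<lambda>a b. \<not> P a b) xs \<longleftrightarrow> (\<forall>a b. subseq [a, b] xs \<longrightarrow> \<not> P a b)"
  by (induction xs) (auto simp: subseq_Cons_Cons_iff subseq_singleton_left simp del: subseq_Cons2_iff)

lemma subseq_no3: "no3 P xs \<longleftrightarrow> (\<forall>a b c. subseq [a, b, c] xs \<longrightarrow> \<not> P a b c)"
  by (induction xs) (auto simp: subseq_no2 subseq_Cons_Cons_iff simp del: subseq_Cons2_iff)

lemma subseq_no4: "no4 P xs \<longleftrightarrow> (\<forall>a b c d. subseq [a, b, c, d] xs \<longrightarrow> \<not> P a b c d)"
  by (induction xs) (auto simp: subseq_no3 subseq_Cons_Cons_iff simp del: subseq_Cons2_iff)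

text \<open>In these abbreviations the bound variables are listed by position and named
  alphabetically by value.\<close>

abbreviation av123 :: "nat list \<Rightarrow> bool" where
  "av123 \<equiv> no3 (\<lambda>a b c. a < b \<and> b < c)"

abbreviation av132 :: "nat list \<Rightarrow> bool" where
  "av132 \<equiv> no3 (\<lambda>a c b. a < b \<and> b < c)"

abbreviation av1243 :: "nat list \<Rightarrow> bool" where
  "av1243 \<equiv> no4 (\<lambda>a b d c. a < b \<and> b < c \<and> c < d)"

abbreviation av2341 :: "nat list \<Rightarrow> bool" where
  "av2341 \<equiv> no4 (\<lambda>b c d a. a < b \<and> b < c \<and> c < d)"

abbreviation av4123 :: "nat list \<Rightarrow> bool" where
  "av4123 \<equiv> no4 (\<lambda>d a b c. a < b \<and> b < c \<and> c < d)"

lemma avoids_length4: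
  assumes "length \<tau> = 4" "\<And>a b c d. order_isomorphic [a, b, c, d] \<tau> \<longleftrightarrow> P a b c d"
  shows "avoids p \<tau> \<longleftrightarrow> no4 P p"
proof -
  have "(\<exists>s. subseq s p \<and> order_isomorphic s \<tau>) \<longleftrightarrow>
        (\<exists>a b c d. subseq [a, b, c, d] p \<and> order_isomorphic [a, b, c, d] \<tau>)"
  proof
    assume "\<exists>s. subseq s p \<and> order_isomorphic s \<tau>"
    then obtain s where s: "subseq s p" "order_isomorphic s \<tau>" by blast
    then have "length s = 4" using assms(1) by (simp add: order_isomorphic_def)
    then obtain a b c d where "s = [a, b, c, d]"
      by (auto simp: length_Suc_conv numeral_eq_Suc)
    then show "\<exists>a b c d. subseq [a, b, c, d] p \<and> order_isomorphic [a, b, c, d] \<tau>" using s by blast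
  qed blast
  then show ?thesis unfolding avoids_def subseq_no4 assms(2) by blast
qed

lemma avoids_patterns:
  "avoids p [1,2,4,3] \<longleftrightarrow> av1243 p"
  "avoids p [2,3,4,1] \<longleftrightarrow> av2341 p"
  "avoids p [4,1,2,3] \<longleftrightarrow> av4123 p"
proof -
  show "avoids p [1,2,4,3] \<longleftrightarrow> av1243 p"
    by (rule avoids_length4) (auto simp: order_isomorphic_def All_less_Suc2)
  show "avoids p [2,3,4,1] \<longleftrightarrow> av2341 p"
    by (rule avoids_length4) (auto simp: order_isomorphic_def All_less_Suc2)
  show "avoids p [4,1,2,3] \<longleftrightarrow> av4123 p"
    by (rule avoids_length4) (auto simp: order_isomorphic_def All_less_Suc2)
qed

text \<open>The size is read off the list, so that the permutations of all sizes form a single set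
  weighted by \<open>length\<close>.\<close>

definition perms :: "nat list set" where
  "perms = {p. distinct p \<and> set p = {1..length p}}"

definition good :: "nat list \<Rightarrow> bool" where
  "good p \<longleftrightarrow> av1243 p \<and> av2341 p \<and> av4123 p"

lemma avoidance_gf_eq:
  "has_gf {p \<in> perms. good p} length (avoidance_gf {[1,2,4,3], [2,3,4,1], [4,1,2,3]})"
proof -
  have e: "{p \<in> {p \<in> perms. good p}. length p = n} = avoiding_perms n {[1,2,4,3], [2,3,4,1], [4,1,2,3]}" for n
  proof -
    have "distinct p \<and> set p = {1..length p} \<and> length p = n \<longleftrightarrow> set p = {1..n} \<and> distinct p" for p
      using distinct_card[of p] by (metis card_atLeastAtMost diff_Suc_1)
    then have "p \<in> perms \<and> length p = n \<longleftrightarrow> p \<in> permutations_of_set {1..n}" for p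
      unfolding perms_def permutations_of_set_def mem_Collect_eq conj_assoc .
    moreover have "(\<forall>\<tau>\<in>{[1,2,4,3], [2,3,4,1], [4,1,2,3]}. avoids p \<tau>) \<longleftrightarrow> good p" for p
      unfolding good_def ball_simps avoids_patterns by blast
    ultimately show ?thesis
      unfolding avoiding_perms_def by blast
  qed
  have "finite (avoiding_perms n S)" for n S
    unfolding avoiding_perms_def by auto
  then show ?thesis unfolding has_gf_def e avoidance_gf_def by simp
qed

section \<open>Permutations avoiding 123\<close>

lemma Nil_in_perms [simp]: "[] \<in> perms"
  by (simp add: perms_def)

lemma perms_insert_max:
  assumes "N = Suc (length (L @ R))"
  shows "L @ N # R \<in> perms \<longleftrightarrow> L @ R \<in> perms"
proof -
  have "{1..N} = insert N {1..length (L @ R)}" "N \<notin> {1..length (L @ R)}"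
    using assms by auto
  then have "insert N (set (L @ R)) = {1..N} \<and> N \<notin> set (L @ R) \<longleftrightarrow> set (L @ R) = {1..length (L @ R)}"
    by (metis insert_ident)
  moreover have "L @ N # R \<in> perms \<longleftrightarrow>
      distinct (L @ R) \<and> insert N (set (L @ R)) = {1..N} \<and> N \<notin> set (L @ R)"
    using assms unfolding perms_def by auto
  ultimately show ?thesis unfolding perms_def by blast
qed

lemma perms_lessD: "p \<in> perms \<Longrightarrow> x \<in> set p \<Longrightarrow> x < Suc (length p)"
  unfolding perms_def by auto

lemma perms_max_split:
  assumes "p \<in> perms" "p \<noteq> []"
  obtains L R where "p = L @ Suc (length (L @ R)) # R" "L @ R \<in> perms"
proof -
  have "length p \<in> set p" using assms by (auto simp: perms_def Suc_le_eq)
  then obtain L R where p: "p = L @ length p # R" by (meson split_list)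
  then have "length p = Suc (length (L @ R))" by (metis length_append length_Cons add_Suc_right)
  then have "p = L @ Suc (length (L @ R)) # R" using p by simp
  then show thesis using that assms(1) perms_insert_max by metis
qed

section \<open>Decreasing lists and insertion of the maximum\<close>

lemma sorted_wrt_all: "(\<And>x y. x \<in> set xs \<Longrightarrow> y \<in> set xs \<Longrightarrow> P x y) \<Longrightarrow> sorted_wrt P xs"
  by (induction xs) auto

lemma sorted_wrt_cong_set:
  "(\<And>x y. x \<in> set xs \<Longrightarrow> y \<in> set xs \<Longrightarrow> P x y \<longleftrightarrow> Q x y) \<Longrightarrow> sorted_wrt P xs \<longleftrightarrow> sorted_wrt Q xs"
  by (induction xs) auto

lemma dec_append: "dec (xs @ ys) \<longleftrightarrow> dec xs \<and> dec ys \<and> (\<forall>x\<in>set xs. \<forall>y\<in>set ys. y < x)"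
  by (auto simp: sorted_wrt_append)

lemma dec_imp_sorted_wrt: "dec xs \<Longrightarrow> (\<And>x y. x \<in> set xs \<Longrightarrow> y \<in> set xs \<Longrightarrow> y < x \<Longrightarrow> P x y) \<Longrightarrow> sorted_wrt P xs"
  by (induction xs) auto

lemma dec_no3: "dec xs \<Longrightarrow> (\<And>x y z. y < x \<Longrightarrow> z < y \<Longrightarrow> \<not> P x y z) \<Longrightarrow> no3 P xs"
  by (induction xs) (auto intro: dec_imp_sorted_wrt)

lemma dec_not_less: "distinct xs \<Longrightarrow> sorted_wrt (\<lambda>x y. \<not> x < y) xs \<longleftrightarrow> dec xs"
  by (induction xs) (auto simp: not_less order.order_iff_strict)

text \<open>The maximum can only be the 3 of a 123, so a new occurrence is exactly an ascent of
  \<open>L\<close> followed by \<open>N\<close>.\<close>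

lemma av123_insert_max:
  assumes "distinct (L @ R)" "\<And>x. x \<in> set (L @ R) \<Longrightarrow> x < N"
  shows "av123 (L @ N # R) \<longleftrightarrow> av123 (L @ R) \<and> dec L"
proof -
  have 1: "sorted_wrt (\<lambda>b c. \<not> (N < b \<and> b < c)) R"
    using assms(2) by (intro sorted_wrt_all) (auto dest: less_asym)
  have 2: "sorted_wrt (\<lambda>a b. \<not> (a < b \<and> b < N)) L \<longleftrightarrow> dec L"
  proof -
    have "sorted_wrt (\<lambda>a b. \<not> (a < b \<and> b < N)) L \<longleftrightarrow> sorted_wrt (\<lambda>a b. \<not> a < b) L"
      using assms(2) by (intro sorted_wrt_cong_set) simp
    moreover have "\<dots> \<longleftrightarrow> dec L" using assms(1) by (intro dec_not_less) simp
    ultimately show ?thesis by simp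
  qed
  have "x \<in> set L \<Longrightarrow> y \<in> set R \<Longrightarrow> \<not> (x < N \<and> N < y)" for x y
    using assms(2)[of y] by auto
  then show ?thesis using 1 2 by (simp add: no3_append) blast
qed

text \<open>By \<open>av123_insert_max\<close> the admissible positions for a new maximum are
  governed by the initial decreasing run. A recurrence therefore needs the length of this run as a
  second statistic; here \<open>j\<close> is a lower bound for it.\<close>

definition runs :: "nat \<Rightarrow> nat \<Rightarrow> nat list set" where
  "runs n j = {p \<in> perms. av123 p \<and> length p = n \<and> j \<le> n \<and> dec (take j p)}"

definition insert_max :: "nat \<Rightarrow> nat list \<Rightarrow> nat list" where
  "insert_max i p = take i p @ Suc (length p) # drop i p"

lemma finite_runs: "finite (runs n j)"
proof (rule finite_subset)
  show "runs n j \<subseteq> permutations_of_set {1..n}"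
    by (auto simp: runs_def perms_def permutations_of_set_def)
qed simp

lemma inj_insert_max: "inj_on (insert_max i) {p. p \<in> perms \<and> i \<le> length p}"
proof (rule inj_onI; clarify)
  fix p q assume *: "insert_max i p = insert_max i q" "i \<le> length p" "i \<le> length q"
  then have "take i p = take i q" "drop i p = drop i q"
    unfolding insert_max_def by (subst (asm) append_eq_append_conv; simp)+
  then show "p = q" by (metis append_take_drop_id)
qed

text \<open>The maximum must be inserted inside the initial decreasing run: at a position \<open>j > 0\<close> it cuts
  this run down to length \<open>j\<close>, and in front it makes the run longer by one.\<close>

lemma runs_Suc:
  assumes "j > 0"
  shows "runs (Suc n) j = runs (Suc n) (Suc j) \<union>
    (insert_max j ` runs n j \<union> insert_max 0 ` (runs n (j - 1) - runs n j))" (is "?l = ?r")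
proof (intro equalityI subsetI)
  fix q assume q: "q \<in> ?l"
  then have "q \<in> perms" "q \<noteq> []" by (auto simp: runs_def)
  then obtain L R where LR: "q = L @ Suc (length (L @ R)) # R" "L @ R \<in> perms"
    by (rule perms_max_split)
  have n: "length (L @ R) = n" and av: "av123 q" and dj: "dec (take j q)" "j \<le> Suc n"
    using q LR(1) by (auto simp: runs_def)
  have d: "distinct (L @ R)" using LR(2) by (simp add: perms_def)
  have lt: "x < Suc n" if "x \<in> set (L @ R)" for x
    using perms_lessD[OF LR(2) that] n by simp
  have av': "av123 (L @ R)" "dec L"
    using av LR(1) av123_insert_max[OF d lt] n by auto
  show "q \<in> ?r"
  proof (cases "L = []")
    case True
    then have qR: "q = insert_max 0 R" using LR by (simp add: insert_max_def)
    have "dec (take k q) \<longleftrightarrow> dec (take (k - 1) R)" if "k > 0" for k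
      using that lt LR(1) n True by (cases k) (auto dest: in_set_takeD)
    then have "dec (take (j - 1) R)" "dec (take (Suc j) q) \<longleftrightarrow> dec (take j R)" using dj assms by auto
    then show ?thesis
      using True qR LR av' n dj q by (auto simp: runs_def)
  next
    case False
    then have less: "\<exists>x\<in>set L. x < Suc n" using lt by (cases L) auto
    have jl: "j \<le> length L"
    proof (rule ccontr)
      assume "\<not> j \<le> length L"
      then have "take j q = L @ Suc n # take (j - length L - 1) R"
        using LR(1) n by (simp add: take_Cons')
      then have "\<forall>x\<in>set L. Suc n < x" using dj(1) by (simp add: sorted_wrt_append)
      then show False using less less_asym by blast
    qed
    show ?thesis
    proof (cases "j = length L")
      case True
      then have "q = insert_max j (L @ R)" "L @ R \<in> runs n j"
        using LR n av' by (auto simp: insert_max_def runs_def)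
      then show ?thesis by blast
    next
      case False
      then have "take (Suc j) q = take (Suc j) L" using jl LR by simp
      then have "dec (take (Suc j) q)" using av'(2) by (simp add: sorted_wrt_take)
      then show ?thesis using q False jl n by (auto simp: runs_def)
    qed
  qed
next
  fix q assume q: "q \<in> ?r"
  then consider "q \<in> runs (Suc n) (Suc j)" | p where "q = insert_max j p" "p \<in> runs n j"
    | p where "q = insert_max 0 p" "p \<in> runs n (j - 1)" by auto
  then show "q \<in> ?l"
  proof cases
    case 1
    then have "dec (take j (take (Suc j) q))" unfolding runs_def by (blast intro: sorted_wrt_take)
    then show ?thesis using 1 by (simp add: runs_def min_def)
  next
    case 2
    let ?L = "take j p" and ?R = "drop j p"
    have p: "p \<in> perms" "av123 p" "length p = n" "j \<le> n" "dec ?L" using 2 by (auto simp: runs_def)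
    have "av123 (?L @ Suc n # ?R) \<longleftrightarrow> av123 (?L @ ?R) \<and> dec ?L"
      using p perms_lessD[OF p(1)] by (intro av123_insert_max) (auto simp: perms_def)
    moreover have "q \<in> perms"
      using perms_insert_max[of "Suc n" ?L ?R] p 2 by (simp add: insert_max_def)
    ultimately show ?thesis using p 2 by (auto simp: runs_def insert_max_def)
  next
    case 3
    have p: "p \<in> perms" "av123 p" "length p = n" "dec (take (j - 1) p)" using 3 by (auto simp: runs_def)
    have "av123 ([] @ Suc n # p) \<longleftrightarrow> av123 ([] @ p) \<and> dec []"
      using p perms_lessD[OF p(1)] by (intro av123_insert_max) (auto simp: perms_def)
    moreover have "q \<in> perms"
      using perms_insert_max[of "Suc n" "[]" p] p 3 by (simp add: insert_max_def)
    moreover have "dec (take j q)"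
      using p 3 assms perms_lessD[OF p(1)] by (cases j) (auto simp: insert_max_def dest: in_set_takeD)
    ultimately show ?thesis using p 3 by (auto simp: runs_def insert_max_def)
  qed
qed

text \<open>The contributions of \<open>runs n j\<close> cancel: insertion at \<open>j\<close> adds
  their number, and insertion in front requires a run of length exactly \<open>j - 1\<close>, which
  subtracts it again. What remains is the recurrence of the ballot numbers.\<close>

lemma card_runs_Suc:
  assumes "j > 0"
  shows "card (runs (Suc n) j) = card (runs (Suc n) (Suc j)) + card (runs n (j - 1))"
proof -
  let ?A = "runs (Suc n) (Suc j)" and ?B = "insert_max j ` runs n j"
    and ?C = "insert_max 0 ` (runs n (j - 1) - runs n j)"
  have sub: "runs n j \<subseteq> runs n (j - 1)"
  proof
    fix p assume p: "p \<in> runs n j"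
    then have "dec (take (j - 1) (take j p))" unfolding runs_def by (blast intro: sorted_wrt_take)
    then show "p \<in> runs n (j - 1)" using p by (auto simp: runs_def min_def)
  qed
  have "\<not> dec (take (Suc j) (insert_max j p))" if "p \<in> runs n j" for p
  proof
    have p: "p \<in> perms" "length p = n" "j \<le> n" using that by (auto simp: runs_def)
    then have "take (Suc j) (insert_max j p) = take j p @ [Suc n]" by (simp add: insert_max_def)
    moreover assume "dec (take (Suc j) (insert_max j p))"
    moreover obtain x where "x \<in> set (take j p)" using p assms by (cases "take j p") auto
    ultimately have "x < Suc n" "Suc n < x"
      using perms_lessD[OF p(1) in_set_takeD] p(2) by (auto simp: dec_append)
    then show False by simp
  qed
  \<comment> \<open>As \<open>j > 0\<close>, a maximum at position \<open>j\<close> follows a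
    smaller entry and stops the run there.\<close>
  then have AB: "?A \<inter> ?B = {}" by (auto simp: runs_def[of _ "Suc j"])
  have AC: "?A \<inter> ?C = {}"
    by (auto simp: runs_def insert_max_def)
  \<comment> \<open>The two kinds of images differ in their first entry: an old entry after
    insertion at \<open>j > 0\<close>, the maximum after insertion in front.\<close>
  have BC: "?B \<inter> ?C = {}"
  proof -
    have False if "p \<in> runs n j" "p' \<in> runs n (j - 1)" "insert_max j p = insert_max 0 p'" for p p'
    proof -
      have "p \<noteq> []" using that(1) assms by (auto simp: runs_def)
      then have "hd (insert_max j p) = hd p" "hd p \<in> set p" using assms by (auto simp: insert_max_def hd_append)
      moreover have "hd (insert_max 0 p') = Suc (length p)" using that by (auto simp: insert_max_def runs_def)
      ultimately show False using that(1,3) perms_lessD[of p "hd p"] by (auto simp: runs_def)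
    qed
    then show ?thesis by blast
  qed
  have inj: "inj_on (insert_max j) (runs n j)" "inj_on (insert_max 0) (runs n (j - 1) - runs n j)"
    by (rule inj_on_subset[OF inj_insert_max]; auto simp: runs_def)+
  have "card (runs (Suc n) j) = card ?A + (card ?B + card ?C)"
    unfolding runs_Suc[OF assms] using AB AC BC finite_runs
    by (simp add: card_Un_disjoint Int_Un_distrib)
  also have "card ?B + card ?C = card (runs n j) + (card (runs n (j - 1)) - card (runs n j))"
    using inj sub finite_runs by (simp add: card_image card_Diff_subset)
  also have "\<dots> = card (runs n (j - 1))"
    using card_mono[OF finite_runs sub] by simp
  finally show ?thesis .
qed

lemma runs_0_1: "runs (Suc n) 0 = runs (Suc n) 1"
  by (auto simp: runs_def length_Suc_conv)

lemma runs_empty: "n < j \<Longrightarrow> runs n j = {}"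
  by (auto simp: runs_def)

lemma runs_diag: "card (runs n n) = 1"
proof (induction n)
  case 0
  have "runs 0 0 = {[]}" by (auto simp: runs_def)
  then show ?case by simp
next
  case (Suc n)
  then show ?case using card_runs_Suc[of "Suc n" n] runs_empty[of "Suc n" "Suc (Suc n)"] by simp
qed

text \<open>These are ballot numbers, with \<open>m = n - j\<close>. Of the two terms of the
  recurrence one has smaller \<open>m\<close>, the other the same \<open>m\<close> and smaller
  \<open>j\<close>, and they add up by Pascal's rule. The case distinction keeps the truncated
  \<open>m - 1\<close> from producing a spurious binomial at \<open>m = 0\<close>.\<close>

lemma card_runs:
  "real (card (runs (j + m) j)) =
     real ((j + 2 * m) choose m) - (if m = 0 then 0 else real ((j + 2 * m) choose (m - 1)))"
proof (induction m arbitrary: j)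
  case 0
  then show ?case by (simp add: runs_diag)
next
  case (Suc m)
  note IH = Suc.IH
  show ?case
  proof (induction j)
    case 0
    \<comment> \<open>The recurrence needs \<open>j > 0\<close>. At \<open>j = 0\<close> the bound
      can be raised to 1 for free, which lowers \<open>m\<close>; the symmetry of the two middle
      binomials then matches the closed forms.\<close>
    have "card (runs (0 + Suc m) 0) = card (runs (1 + m) 1)"
      using runs_0_1[of m] by simp
    moreover have "Suc (2 * m) choose Suc m = Suc (2 * m) choose m"
      by (rule binomial_symmetric[THEN trans]) (auto simp: Suc_diff_le)
    ultimately show ?case using IH[of 1] by (cases m) (auto simp: binomial_Suc_Suc)
  next
    case (Suc j)
    have "card (runs (Suc j + Suc m) (Suc j)) = card (runs (Suc (Suc j) + m) (Suc (Suc j))) + card (runs (j + Suc m) j)"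
      using card_runs_Suc[of "Suc j" "j + Suc m"] by simp
    then show ?case using IH[of "Suc (Suc j)"] Suc.IH by (cases m) (auto simp: binomial_Suc_Suc)
  qed
qed

text \<open>For \<open>j = 0\<close> the ballot number is the difference form of the Catalan number,
  the central binomial minus its left neighbour.\<close>

lemma has_gf_av123: "has_gf {p \<in> perms. av123 p} length catalan_gf"
  unfolding has_gf_def
proof
  fix n
  have e: "{p \<in> {p \<in> perms. av123 p}. length p = n} = runs n 0" by (auto simp: runs_def)
  have "real ((2 * n) choose n) - (if n = 0 then 0 else real ((2 * n) choose (n - 1)))
      = real ((2 * n) choose n) / real (n + 1)"
  proof (cases n)
    case (Suc k)
    have "Suc k * ((2 * n) choose Suc k) = (2 * n - k) * ((2 * n) choose k)"
      using binomial_absorb_comp[of "2 * n" k] binomial_absorption[of k "2*n"] by (simp add: algebra_simps)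
    then have "real (Suc k) * real ((2 * n) choose n) = (real n + 1) * real ((2 * n) choose k)"
      using Suc by (metis (mono_tags, lifting) of_nat_mult of_nat_Suc Suc_eq_plus1 add_diff_cancel_right' add_Suc_right mult_2 add_Suc add.commute diff_add_inverse)
    then show ?thesis using Suc by (simp add: field_simps)
  qed simp
  then show "finite {p \<in> {p \<in> perms. av123 p}. length p = n} \<and>
      real (card {p \<in> {p \<in> perms. av123 p}. length p = n}) = fps_nth catalan_gf n"
    unfolding e catalan_gf_nth using finite_runs[of n 0] card_runs[of 0 n] by (simp only: add_0)
qed

section \<open>Permutations avoiding 123 and 132\<close>

text \<open>Sorting both lists and concatenating yields the increasing enumeration of the interval,
  so the lengths alone fix the cut. This is how actual values are recovered from the relative order
  of blocks.\<close>

lemma upt_split: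
  assumes "set xs \<union> set ys = {i..<k}" "distinct xs" "distinct ys"
    and "\<And>x y. x \<in> set xs \<Longrightarrow> y \<in> set ys \<Longrightarrow> x < y"
  shows "set xs = {i..<i + length xs}" "set ys = {i + length xs..<k}"
proof -
  let ?zs = "sort xs @ sort ys"
  have "sorted ?zs" using assms(4) by (auto simp: sorted_append less_imp_le)
  moreover have "distinct ?zs" using assms(2-4) by fastforce
  moreover have "set ?zs = {i..<k}" using assms(1) by simp
  ultimately have *: "?zs = [i..<k]"
    by (metis sorted_list_of_set_sort_remdups distinct_remdups_id sorted_sort_id sorted_list_of_set_range)
  then have len: "length xs + length ys = k - i" by (metis length_append length_sort length_upt)
  have "take (length xs) ?zs = sort xs" "drop (length xs) ?zs = sort ys" by simp_all
  then have "sort xs = take (length xs) [i..<k]" "sort ys = drop (length xs) [i..<k]"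
    unfolding * by simp_all
  moreover have "take (length xs) [i..<k] = [i..<i + length xs]"
    using len by (cases xs) (auto intro!: take_upt simp del: take_Suc_Cons)
  ultimately have "sort xs = [i..<i + length xs]" "sort ys = [i + length xs..<k]"
    by (simp_all add: drop_upt)
  then show "set xs = {i..<i + length xs}" "set ys = {i + length xs..<k}"
    by (metis set_sort set_upt)+
qed

lemma dec_rev_upt [simp]: "dec (rev [i..<k])"
  by (simp add: sorted_wrt_rev)

lemma dec_eqI:
  assumes "dec xs" "dec ys" "set xs = set ys"
  shows "xs = ys"
proof -
  have "rev xs = rev ys"
    using assms by (intro strict_sorted_equal) (simp_all add: sorted_wrt_rev)
  then show ?thesis by simp
qed

lemma dec_distinct: "dec xs \<Longrightarrow> distinct xs"
  by (induction xs) auto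

lemma dec_eq_rev_upt: "dec xs \<Longrightarrow> set xs = {i..<k} \<Longrightarrow> xs = rev [i..<k]"
  by (rule dec_eqI) simp_all

lemma no3_map: "no3 P (map f xs) \<longleftrightarrow> no3 (\<lambda>a b c. P (f a) (f b) (f c)) xs"
  by (induction xs) (simp_all add: sorted_wrt_map)

lemma dec_map_add [simp]: "dec (map ((+) c) xs) \<longleftrightarrow> dec xs"
  by (simp add: sorted_wrt_map)

text \<open>Standardisation of a block of consecutive values.\<close>

lemma perms_shift:
  assumes "set xs = {i..<k}" "distinct xs" "i > 0"
  obtains ys where "ys \<in> perms" "xs = map ((+) (i - 1)) ys"
proof
  let ?ys = "map (\<lambda>x. x - (i - 1)) xs"
  have "length xs = k - i" using assms by (metis card_atLeastLessThan distinct_card)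
  moreover have "(\<lambda>x. x - (i - 1)) ` {i..<k} = {1..k - i}"
  proof (intro equalityI subsetI)
    fix x assume "x \<in> {1..k - i}"
    then have "x = (x + (i - 1)) - (i - 1)" "x + (i - 1) \<in> {i..<k}" using assms(3) by auto
    then show "x \<in> (\<lambda>x. x - (i - 1)) ` {i..<k}" by (rule image_eqI)
  qed (use assms(3) in auto)
  ultimately have "set ?ys = {1..length ?ys}"
    using assms(1) by simp
  moreover have "distinct ?ys" using assms by (auto simp: distinct_map inj_on_def)
  ultimately show "?ys \<in> perms" by (simp add: perms_def)
  show "xs = map ((+) (i - 1)) ?ys"
    using assms by (auto simp: comp_def intro!: map_idI[symmetric])
qed

definition layered :: "nat list set" where
  "layered = {p \<in> perms. av123 p \<and> av132 p}"

definition decreasing :: "nat list set" where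
  "decreasing = {p \<in> perms. dec p}"

text \<open>An unknown series can be named first and then determined from an equation, as is done
  for \<open>layered\<close> and for the 123-avoiders whose maximum is not last.\<close>

lemma has_gf_exists:
  assumes "\<And>n. finite {x \<in> S. sz x = n}"
  shows "\<exists>f. has_gf S sz f"
proof
  show "has_gf S sz (Abs_fps (\<lambda>n. real (card {x \<in> S. sz x = n})))"
    using assms by (simp add: has_gf_def)
qed

lemma finite_perms_length: "finite {p \<in> perms. P p \<and> length p = n}"
proof (rule finite_subset)
  show "{p \<in> perms. P p \<and> length p = n} \<subseteq> permutations_of_set {1..n}"
    by (auto simp: perms_def permutations_of_set_def)
qed simp

lemma decreasing_eq: "decreasing = range (\<lambda>k. rev [1..<Suc k])"
proof (intro equalityI subsetI)
  fix p assume "p \<in> decreasing"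
  then have "dec p" "set p = {1..<Suc (length p)}"
    by (simp_all add: decreasing_def perms_def atLeastLessThanSuc_atLeastAtMost)
  then have "p = rev [1..<Suc (length p)]" by (rule dec_eq_rev_upt)
  then show "p \<in> range (\<lambda>k. rev [1..<Suc k])" by blast
next
  fix p assume "p \<in> range (\<lambda>k. rev [1..<Suc k])"
  then obtain k where p: "p = rev [1..<Suc k]" by blast
  have "set p = {1..k}" "length p = k" "distinct p" "dec p"
    unfolding p by (simp_all del: upt_Suc add: atLeastLessThanSuc_atLeastAtMost)
  then show "p \<in> decreasing" by (simp add: decreasing_def perms_def)
qed

lemma has_gf_decreasing: "has_gf decreasing length (inverse (1 - fps_X))"
proof -
  have "inj (\<lambda>k. rev [1..<Suc k])"
    by (rule injI) (metis length_rev length_upt diff_Suc_1)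
  from has_gf_image[OF has_gf_nat this, of length 0]
  show ?thesis by (simp add: decreasing_eq del: upt_Suc)
qed

section \<open>Subsequences of two and three entries\<close>

declare subseq_Cons2_iff [simp del] subseq_singleton_left [simp]

lemma subseq2_append:
  "subseq [a, b] (xs @ ys) \<longleftrightarrow> subseq [a, b] xs \<or> a \<in> set xs \<and> b \<in> set ys \<or> subseq [a, b] ys"
  by (induction xs) (auto simp: subseq_Cons_Cons_iff)

lemma subseq3_append:
  "subseq [a, b, c] (xs @ ys) \<longleftrightarrow> subseq [a, b, c] xs \<or> subseq [a, b] xs \<and> c \<in> set ys \<or>
     a \<in> set xs \<and> subseq [b, c] ys \<or> subseq [a, b, c] ys"
  by (induction xs) (auto simp: subseq_Cons_Cons_iff subseq2_append)

lemma subseq2_Cons: "subseq [a, b] (x # xs) \<longleftrightarrow> a = x \<and> b \<in> set xs \<or> subseq [a, b] xs"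
  by (auto simp: subseq_Cons_Cons_iff)

lemma subseq3_Cons: "subseq [a, b, c] (x # xs) \<longleftrightarrow> a = x \<and> subseq [b, c] xs \<or> subseq [a, b, c] xs"
  by (auto simp: subseq_Cons_Cons_iff)

lemma subseq2D: "subseq [a, b] xs \<Longrightarrow> a \<in> set xs \<and> b \<in> set xs"
  by (induction xs) (auto simp: subseq2_Cons)

lemma subseq3D: "subseq [a, b, c] xs \<Longrightarrow> subseq [a, b] xs \<and> subseq [b, c] xs \<and> subseq [a, c] xs"
  by (induction xs) (auto simp: subseq2_Cons subseq3_Cons dest: subseq2D)

lemma decD: "dec xs \<Longrightarrow> subseq [a, b] xs \<Longrightarrow> b < a"
  by (induction xs) (auto simp: subseq2_Cons)

lemma decI: "(\<And>a b. subseq [a, b] xs \<Longrightarrow> b < a) \<Longrightarrow> dec xs"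
  by (induction xs) (auto simp: subseq2_Cons)

lemma av123D: "av123 xs \<Longrightarrow> subseq [a, b, c] xs \<Longrightarrow> a < b \<Longrightarrow> b < c \<Longrightarrow> False"
  by (simp add: subseq_no3)

lemma av132D: "av132 xs \<Longrightarrow> subseq [a, c, b] xs \<Longrightarrow> a < b \<Longrightarrow> b < c \<Longrightarrow> False"
  by (simp add: subseq_no3)

text \<open>In 123 and in 132 the first entry is the smallest, so two larger entries must follow it.
  After an entry of \<open>L\<close> only \<open>N\<close> is larger, and after \<open>N\<close>
  nothing is; hence every occurrence lies in \<open>R\<close>.\<close>

lemma av_layer_cons:
  assumes "dec L" "\<And>x. x \<in> set L \<Longrightarrow> x < N" "\<And>x y. x \<in> set L \<Longrightarrow> y \<in> set R \<Longrightarrow> y < x"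
    and "\<And>y. y \<in> set R \<Longrightarrow> y < N"
  shows "av123 (L @ N # R) \<longleftrightarrow> av123 R" "av132 (L @ N # R) \<longleftrightarrow> av132 R"
proof -
  have "\<not> (a < b \<and> b < c) \<and> \<not> (a < c \<and> c < b)"
    if abc: "subseq [a, b, c] (L @ N # R)" "\<not> subseq [a, b, c] R" for a b c
  proof -
    consider "subseq [a, b] L" | "a \<in> set L" "b = N" "c \<in> set R" | "a \<in> set L" "b \<in> set R" "c \<in> set R"
      | "a = N" "b \<in> set R" "c \<in> set R"
      using abc unfolding subseq3_append subseq2_Cons subseq3_Cons
      by (auto dest: subseq3D subseq2D)
    then show ?thesis
    proof cases
      case 1
      then show ?thesis using decD[OF assms(1), of a b] by auto
    next
      case 2
      then show ?thesis using assms(3)[of a c] assms(4)[of c] by simp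
    next
      case 3
      then show ?thesis using assms(3)[of a b] assms(3)[of a c] by simp
    next
      case 4
      then show ?thesis using assms(4)[of b] assms(4)[of c] by simp
    qed
  qed
  moreover have "subseq [a, b, c] R \<Longrightarrow> subseq [a, b, c] (L @ N # R)" for a b c
    by (simp add: subseq3_append subseq3_Cons)
  ultimately show "av123 (L @ N # R) \<longleftrightarrow> av123 R" "av132 (L @ N # R) \<longleftrightarrow> av132 R"
    unfolding subseq_no3 by blast+
qed

definition add_layer :: "nat \<times> nat list \<Rightarrow> nat list" where
  "add_layer = (\<lambda>(k, Y). rev [Suc (length Y)..<Suc (length Y + k)] @ Suc (length Y + k) # Y)"

text \<open>Avoiding 123 makes the part before the maximum decreasing, and avoiding 132 puts it
  above the part after the maximum. So its length \<open>k\<close> determines it, and the rest is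
  again layered.\<close>

lemma layered_eq: "layered = {[]} \<union> add_layer ` (UNIV \<times> layered)"
proof (intro equalityI subsetI)
  fix p assume p: "p \<in> layered"
  show "p \<in> {[]} \<union> add_layer ` (UNIV \<times> layered)"
  proof (cases "p = []")
    case False
    then obtain L R where LR: "p = L @ Suc (length (L @ R)) # R" "L @ R \<in> perms"
      using p perms_max_split by (auto simp: layered_def)
    let ?N = "Suc (length (L @ R))"
    have d: "distinct (L @ R)" "set (L @ R) = {1..<?N}" using LR(2) by (auto simp: perms_def)
    have lt: "\<And>x. x \<in> set (L @ R) \<Longrightarrow> x < ?N" using LR(2) perms_lessD by blast
    have L: "dec L"
      using av123_insert_max[OF d(1) lt] p LR(1) by (auto simp: layered_def)
    have RL: "y < x" if "x \<in> set L" "y \<in> set R" for x y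
    proof -
      have "av132 (L @ ?N # R)" using p LR(1) by (auto simp: layered_def)
      then have "\<not> (x < y \<and> y < ?N)" using that by (auto simp: no3_append)
      moreover have "x \<noteq> y" using that d by auto
      ultimately show ?thesis using lt[of y] that by auto
    qed
    have R: "set R = {1..<1 + length R}" "set L = {1 + length R..<?N}"
      using upt_split[of R L 1 ?N] d RL by (auto simp: Un_commute)
    have "av123 (L @ ?N # R) \<longleftrightarrow> av123 R" "av132 (L @ ?N # R) \<longleftrightarrow> av132 R"
      by (rule av_layer_cons[OF L]; use lt RL in auto)+
    moreover have "R \<in> perms" using R(1) d by (auto simp: perms_def)
    ultimately have "R \<in> layered"
      using p LR(1) by (simp add: layered_def)
    moreover have "L = rev [1 + length R..<?N]" by (rule dec_eq_rev_upt[OF L R(2)])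
    ultimately have "p = add_layer (length L, R)"
      using LR(1) by (simp add: add_layer_def add.commute)
    then show ?thesis using \<open>R \<in> layered\<close> by blast
  qed simp
next
  fix p assume "p \<in> {[]} \<union> add_layer ` (UNIV \<times> layered)"
  then consider "p = []" | k Y where "p = add_layer (k, Y)" "Y \<in> layered" by auto
  then show "p \<in> layered"
  proof cases
    case 2
    then have Y: "distinct Y" "set Y = {1..length Y}" "av123 Y" "av132 Y"
      by (auto simp: layered_def perms_def)
    then have "distinct p"
      using 2(1) by (auto simp: add_layer_def)
    moreover have "set p = {1..length p}"
      unfolding 2(1) add_layer_def prod.case set_append list.set set_rev set_upt Y(2)
      by auto
    moreover have "y \<le> length Y" if "y \<in> set Y" for y using Y(2) that by simp
    then have "av123 p" "av132 p"
      unfolding 2 add_layer_def prod.case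
      by (subst av_layer_cons; use Y(3,4) in \<open>force simp del: upt_Suc\<close>)+
    ultimately show ?thesis by (simp add: layered_def perms_def)
  qed (simp add: layered_def)
qed

lemma inj_add_layer: "inj_on add_layer (UNIV \<times> layered)"
proof (rule inj_onI)
  fix u v assume uv: "u \<in> UNIV \<times> layered" "v \<in> UNIV \<times> layered" "add_layer u = add_layer v"
  obtain k Y k' Y' where e: "u = (k, Y)" "v = (k', Y')" by fastforce
  let ?N = "Suc (length Y + k)"
  have "length (add_layer u) = length (add_layer v)" using uv by simp
  then have N: "length Y + k = length Y' + k'" by (simp add: e add_layer_def del: upt_Suc)
  have Y: "set Y = {1..length Y}" "set Y' = {1..length Y'}"
    using uv e by (auto simp: layered_def perms_def)
  have "rev [Suc (length Y)..<Suc (length Y + k)] @ ?N # Y = rev [Suc (length Y')..<Suc (length Y' + k')] @ ?N # Y'"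
    using uv(3) N by (simp add: e add_layer_def del: upt_Suc)
  then have "Y = Y'" using Y N by (subst (asm) append_Cons_eq_iff) auto
  then show "u = v" using e N by simp
qed

text \<open>\<open>layered_eq\<close> reads \<open>f = 1 + x f / (1 - x)\<close>; multiplying by
  \<open>1 - x\<close> makes this \<open>(1 - 2x) f = 1 - x\<close>.\<close>

lemma has_gf_layered: "has_gf layered length ((1 - fps_X) * inverse (1 - 2 * fps_X))"
proof -
  have "\<exists>f. has_gf layered length f"
    using finite_perms_length[of "\<lambda>p. av123 p \<and> av132 p"]
    by (intro has_gf_exists) (simp add: layered_def conj_assoc)
  then obtain f where f: "has_gf layered length f" by blast
  let ?g = "inverse (1 - fps_X) :: real fps" and ?h = "inverse (1 - 2 * fps_X) :: real fps"
  have "has_gf (add_layer ` (UNIV \<times> layered)) length (fps_X ^ 1 * (?g * f))"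
    by (rule has_gf_image[OF has_gf_times[OF has_gf_nat f] inj_add_layer]) (auto simp: add_layer_def)
  then have "has_gf layered length (fps_X ^ 0 + fps_X ^ 1 * (?g * f))"
    by (subst layered_eq, intro has_gf_Un) (use has_gf_singleton[of "[]" length] in \<open>auto simp: add_layer_def\<close>)
  then have "f = 1 + fps_X * (?g * f)" using has_gf_unique f by fastforce
  then have "(1 - fps_X) * f = (1 - fps_X) * (1 + fps_X * (?g * f))" by (rule arg_cong)
  also have "\<dots> = (1 - fps_X) + fps_X * f * ((1 - fps_X) * ?g)" by (simp add: algebra_simps)
  finally have *: "(1 - 2 * fps_X) * f = 1 - fps_X"
    unfolding inverse_one_minus_X by (simp add: algebra_simps)
  have "f = f * ((1 - 2 * fps_X) * ?h)" unfolding inverse_one_minus_2X by simp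
  also have "\<dots> = (1 - 2 * fps_X) * f * ?h" by (simp only: mult_ac)
  finally have "f = (1 - fps_X) * ?h" unfolding * .
  then show ?thesis using f by simp
qed

section \<open>Binary words with at most two runs, where \<open>False\<close> is below
  \<open>True\<close>\<close>

lemma sorted_bools: "{w. sorted w} = (\<lambda>(a, b). replicate a False @ replicate b True) ` UNIV"
proof (intro equalityI subsetI)
  fix w :: "bool list" assume "w \<in> {w. sorted w}"
  then have "sorted w" by simp
  then have "\<exists>a b. w = replicate a False @ replicate b True"
  proof (induction w)
    case (Cons c w)
    then obtain a b where w: "w = replicate a False @ replicate b True" by auto
    show ?case
    proof (cases c)
      case True
      then have "a = 0" using Cons.prems w by (cases a) auto
      then have "c # w = replicate 0 False @ replicate (Suc b) True" using w True by simp
      then show ?thesis by blast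
    next
      case False
      then have "c # w = replicate (Suc a) False @ replicate b True" using w by simp
      then show ?thesis by blast
    qed
  qed simp
  then show "w \<in> (\<lambda>(a, b). replicate a False @ replicate b True) ` UNIV" by auto
qed (auto simp: sorted_append sorted_replicate)

lemma inj_two_runs: "c \<noteq> d \<Longrightarrow> inj (\<lambda>(a, b). replicate a c @ replicate b d)"
proof (rule injI; clarify)
  fix a b a' b' assume "c \<noteq> d" "replicate a c @ replicate b d = replicate a' c @ replicate b' d"
  then have "length (filter ((=) x) (replicate a c @ replicate b d)) =
      length (filter ((=) x) (replicate a' c @ replicate b' d))" for x
    by simp
  from this[of c] this[of d] show "a = a' \<and> b = b'" using \<open>c \<noteq> d\<close> by simp
qed

lemma has_gf_sorted_bools: "has_gf {w :: bool list. sorted w} length (inverse (1 - fps_X) * inverse (1 - fps_X))"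
proof -
  have "has_gf ((\<lambda>(a, b). replicate a False @ replicate b True) ` (UNIV \<times> UNIV)) length
    (fps_X ^ 0 * (inverse (1 - fps_X) * inverse (1 - fps_X)))"
    by (rule has_gf_image[OF has_gf_times[OF has_gf_nat has_gf_nat]]) (auto simp: inj_two_runs)
  then show ?thesis by (simp add: sorted_bools)
qed

text \<open>The minimal length \<open>e\<close> of the second run is kept variable: it is 1 for the
  words of the straddling case and 0 for sorted words containing \<open>False\<close>.\<close>

lemma has_gf_Suc_runs:
  assumes "c \<noteq> d"
  shows "has_gf ((\<lambda>(a, b). replicate (Suc a) c @ replicate (b + e) d) ` UNIV) length
    (fps_X ^ Suc e * (inverse (1 - fps_X) * inverse (1 - fps_X)))"
proof -
  have "inj (\<lambda>(a, b). replicate (Suc a) c @ replicate (b + e) d)"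
  proof (rule injI; clarify)
    fix a b a' b' assume "replicate (Suc a) c @ replicate (b + e) d = replicate (Suc a') c @ replicate (b' + e) d"
    then have "(Suc a, b + e) = (Suc a', b' + e)"
      using injD[OF inj_two_runs[OF assms], of "(Suc a, b + e)" "(Suc a', b' + e)"] by simp
    then show "a = a' \<and> b = b'" by simp
  qed
  then have "has_gf ((\<lambda>(a, b). replicate (Suc a) c @ replicate (b + e) d) ` (UNIV \<times> UNIV)) length
    (fps_X ^ Suc e * (inverse (1 - fps_X) * inverse (1 - fps_X)))"
    by (intro has_gf_image[OF has_gf_times[OF has_gf_nat has_gf_nat]]) auto
  then show ?thesis by simp
qed

section \<open>Subsequences of four entries and insertion of the maximum into the class\<close>

lemma subseq4_append:
  "subseq [a, b, c, d] (xs @ ys) \<longleftrightarrow> subseq [a, b, c, d] xs \<or> subseq [a, b, c] xs \<and> d \<in> set ys \<or>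
     subseq [a, b] xs \<and> subseq [c, d] ys \<or> a \<in> set xs \<and> subseq [b, c, d] ys \<or> subseq [a, b, c, d] ys"
  by (induction xs) (auto simp: subseq_Cons_Cons_iff subseq3_append)

lemma subseq4_Cons:
  "subseq [a, b, c, d] (x # xs) \<longleftrightarrow> a = x \<and> subseq [b, c, d] xs \<or> subseq [a, b, c, d] xs"
  by (auto simp: subseq_Cons_Cons_iff)

lemma subseq3_set: "subseq [a, b, c] xs \<Longrightarrow> a \<in> set xs \<and> b \<in> set xs \<and> c \<in> set xs"
  by (induction xs) (auto simp: subseq3_Cons dest: subseq2D)

lemma subseq4D:
  "subseq [a, b, c, d] xs \<Longrightarrow> subseq [a, b, c] xs \<and> subseq [b, c, d] xs \<and> subseq [a, b, d] xs \<and> subseq [a, c, d] xs"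
  by (induction xs) (auto simp: subseq3_Cons subseq4_Cons dest: subseq3D)

lemma subseq2_filter: "subseq [a, b] (filter P xs) \<longleftrightarrow> P a \<and> P b \<and> subseq [a, b] xs"
  by (induction xs) (auto simp: subseq2_Cons)

lemma subseq2_map: "subseq [x, y] (map f xs) \<longleftrightarrow> (\<exists>a b. subseq [a, b] xs \<and> f a = x \<and> f b = y)"
  by (induction xs) (auto simp: subseq2_Cons)

lemma subseq2_distinct: "subseq [a, b] xs \<Longrightarrow> distinct xs \<Longrightarrow> a \<noteq> b"
  by (induction xs) (auto simp: subseq2_Cons)

lemma subseq2_total: "a \<in> set xs \<Longrightarrow> b \<in> set xs \<Longrightarrow> a \<noteq> b \<Longrightarrow> subseq [a, b] xs \<or> subseq [b, a] xs"
  by (induction xs) (auto simp: subseq2_Cons)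

lemma subseq2_antisym: "subseq [a, b] xs \<Longrightarrow> subseq [b, a] xs \<Longrightarrow> distinct xs \<Longrightarrow> False"
  by (induction xs) (auto simp: subseq2_Cons dest: subseq2D)

lemma subseq2_trans: "subseq [a, b] xs \<Longrightarrow> subseq [b, c] xs \<Longrightarrow> distinct xs \<Longrightarrow> subseq [a, c] xs"
  by (induction xs) (auto simp: subseq2_Cons dest: subseq2D)

lemma not_dec_obtain:
  assumes "\<not> dec xs" "distinct xs"
  obtains a b where "subseq [a, b] xs" "a < b"
  using assms decI subseq2_distinct by (metis linorder_neqE_nat)

text \<open>The disjuncts are 1243, 2341 and 4123, with the arguments in order of position. A single
  predicate lets one case analysis over positions treat all three patterns.\<close>

definition bad4 :: "nat \<Rightarrow> nat \<Rightarrow> nat \<Rightarrow> nat \<Rightarrow> bool" where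
  "bad4 a b c d \<longleftrightarrow> a < b \<and> b < d \<and> d < c \<or> d < a \<and> a < b \<and> b < c \<or> b < c \<and> c < d \<and> d < a"

lemma good_bad4: "good p \<longleftrightarrow> (\<forall>a b c d. subseq [a, b, c, d] p \<longrightarrow> \<not> bad4 a b c d)"
  unfolding good_def subseq_no4 bad4_def by blast

lemma av123_good: "av123 p \<Longrightarrow> good p"
  unfolding good_bad4 bad4_def subseq_no3 by (blast dest: subseq4D)

text \<open>The maximum can only be the 4 of a pattern. In 4123 it needs a 123 in \<open>R\<close>.
  In 1243 and 2341 it stands third, between an ascent \<open>a < b\<close> of \<open>L\<close> and
  an entry \<open>r\<close> of \<open>R\<close>: \<open>a b N r\<close> is 1243 if
  \<open>b < r\<close> and 2341 if \<open>r < a\<close>.\<close>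

lemma good_insert_max:
  assumes "distinct (L @ R)" "\<And>x. x \<in> set (L @ R) \<Longrightarrow> x < N"
  shows "good (L @ N # R) \<longleftrightarrow> good (L @ R) \<and> av123 R \<and>
    (\<forall>a b r. subseq [a, b] L \<longrightarrow> a < b \<longrightarrow> r \<in> set R \<longrightarrow> a < r \<and> r < b)"
proof (intro iffI conjI allI impI)
  assume g: "good (L @ N # R)"
  show "good (L @ R)"
  proof -
    have "subseq [a, b, c, d] (L @ N # R)" if "subseq [a, b, c, d] (L @ R)" for a b c d
      using that by (auto simp: subseq4_append subseq4_Cons subseq3_Cons subseq2_Cons)
    then show ?thesis using g unfolding good_bad4 by blast
  qed
  show "av123 R"
    unfolding subseq_no3
  proof (intro allI impI)
    fix a b c assume s: "subseq [a, b, c] R"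
    then have "subseq [N, a, b, c] (L @ N # R)" by (simp add: subseq4_append subseq4_Cons)
    moreover have "c < N" using subseq3_set[OF s] assms(2) by simp
    moreover have "\<not> bad4 N a b c" using calculation g unfolding good_bad4 by blast
    ultimately show "\<not> (a < b \<and> b < c)" by (auto simp: bad4_def)
  qed
  fix a b r assume h: "subseq [a, b] L" "a < b" "r \<in> set R"
  then have "subseq [a, b, N, r] (L @ N # R)" by (simp add: subseq4_append subseq2_Cons)
  then have "\<not> bad4 a b N r" using g by (simp add: good_bad4)
  moreover have "r < N" "a \<noteq> r" "b \<noteq> r" "b < N" 
    using h(3) subseq2D[OF h(1)] assms by auto
  ultimately show "a < r" "r < b" using h(2) by (auto simp: bad4_def)
next
  assume g: "good (L @ R) \<and> av123 R \<and>
    (\<forall>a b r. subseq [a, b] L \<longrightarrow> a < b \<longrightarrow> r \<in> set R \<longrightarrow> a < r \<and> r < b)"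
  show "good (L @ N # R)"
    unfolding good_bad4
  proof (intro allI impI notI)
    fix a b c d assume s: "subseq [a, b, c, d] (L @ N # R)" and bad: "bad4 a b c d"
    have LR: "x < N" if "x \<in> set L \<or> x \<in> set R" for x using assms(2) that by auto
    have "subseq [a, b, c, d] (L @ R)"
    proof (rule ccontr)
      assume n: "\<not> subseq [a, b, c, d] (L @ R)"
      consider "subseq [a, b, c] L" "d = N" | "subseq [a, b] L" "c = N" "d \<in> set R"
        | "a \<in> set L" "b = N" "subseq [c, d] R" | "a = N" "subseq [b, c, d] R"
        using s n unfolding subseq4_append subseq4_Cons subseq3_Cons subseq2_Cons list.set by blast
      then show False
      proof cases
        case 1
        then have "a < N" "c < N" using LR subseq3_set[OF 1(1)] by blast+
        then show False using bad 1 by (auto simp: bad4_def)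
      next
        case 2
        then have "a < b \<longrightarrow> a < d \<and> d < b" "a < N" using g LR subseq2D[OF 2(1)] by blast+
        then show False using bad 2 LR[of d] by (auto simp: bad4_def)
      next
        case 3
        then have "c < N" "d < N" using LR subseq2D[OF 3(3)] by blast+
        then show False using bad 3 by (auto simp: bad4_def)
      next
        case 4
        then have "b < N" "d < N" "\<not> (b < c \<and> c < d)"
          using LR subseq3_set[OF 4(2)] av123D[OF _ 4(2)] g by blast+
        then show False using bad 4 by (auto simp: bad4_def)
      qed
    qed
    then show False using g bad unfolding good_bad4 by blast
  qed
qed

section \<open>An ascent before the maximum\<close>

text \<open>The word \<open>w\<close> marks the entries of \<open>L\<close> that are below \<open>R\<close> with \<open>True\<close>.\<close>

definition straddle :: "nat list \<Rightarrow> nat list \<Rightarrow> bool list \<Rightarrow> bool" where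
  "straddle L R w \<longleftrightarrow> R \<noteq> [] \<and> w = map (\<lambda>x. x < hd R) L \<and>
     (\<forall>x\<in>set L. \<forall>r\<in>set R. x < hd R \<longleftrightarrow> x < r) \<and>
     dec (filter (\<lambda>x. x < hd R) L) \<and> dec (filter (\<lambda>x. \<not> x < hd R) L) \<and>
     subseq [True, False] w \<and> av123 R \<and> av132 R \<and> (subseq [False, True] w \<longrightarrow> dec R)"

text \<open>Fix an ascent \<open>a < b\<close> of \<open>L\<close>; all of \<open>R\<close> lies
  between \<open>a\<close> and \<open>b\<close>. A 132 in \<open>R\<close> preceded by
  \<open>a\<close> is a 1243. A large entry of \<open>L\<close>, a later small one and an ascent of
  \<open>R\<close> form a 4123.\<close>

lemma straddleI:
  assumes good: "good (L @ N # R)" and d: "distinct (L @ R)" and lt: "\<And>x. x \<in> set (L @ R) \<Longrightarrow> x < N"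
    and "R \<noteq> []" "\<not> dec L"
  shows "straddle L R (map (\<lambda>x. x < hd R) L)"
proof -
  have g: "good (L @ R)" "av123 R"
    and asc: "\<And>a b r. subseq [a, b] L \<Longrightarrow> a < b \<Longrightarrow> r \<in> set R \<Longrightarrow> a < r \<and> r < b"
    using good_insert_max[OF d lt] good by blast+
  have h: "hd R \<in> set R" using assms by simp
  obtain a b where ab: "subseq [a, b] L" "a < b"
    using not_dec_obtain[OF \<open>\<not> dec L\<close>] d by auto
  note abr = asc[OF ab]
  have abL: "a \<in> set L" "b \<in> set L" using subseq2D[OF ab(1)] by simp_all
  have sides: "x < r \<longleftrightarrow> x < r'" if x: "x \<in> set L" and r: "r \<in> set R" "r' \<in> set R" for x r r'
  proof -
    \<comment> \<open>An entry \<open>x\<close> with values of \<open>R\<close> on both sides cannot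
      come after \<open>a\<close> or before \<open>b\<close>, since each would give an ascent of
      \<open>L\<close> that does not straddle \<open>R\<close>. It would then stand after
      \<open>b\<close> and before \<open>a\<close>, although \<open>a\<close> precedes
      \<open>b\<close>.\<close>
    have False if "x < r" "\<not> x < r'" "r \<in> set R" "r' \<in> set R" for r r'
    proof -
      have "x \<noteq> a" using abr[OF that(4)] that by auto
      moreover have "\<not> subseq [a, x] L"
        using asc[of a x r] abr[OF that(4)] that by auto
      ultimately have "subseq [x, a] L" using subseq2_total[of x L a] x abL by blast
      have "x \<noteq> b" using abr[OF that(3)] that by auto
      moreover have "\<not> subseq [x, b] L"
        using asc[of x b r'] abr[OF that(3)] that by auto
      ultimately have "subseq [b, x] L" using subseq2_total[of x L b] x abL by blast
      then show False
        using subseq2_trans[OF _ \<open>subseq [x, a] L\<close>] subseq2_antisym[OF ab(1)] d by auto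
    qed
    then show ?thesis using r by blast
  qed
  have "dec (filter (\<lambda>x. x < hd R) L)" "dec (filter (\<lambda>x. \<not> x < hd R) L)"
    using asc[OF _ _ h] d subseq2_distinct[of _ _ L]
    by (auto intro!: decI simp: subseq2_filter) (metis less_asym linorder_neqE_nat)+
  moreover have "subseq [True, False] (map (\<lambda>x. x < hd R) L)"
    unfolding subseq2_map using ab(1) abr[OF h] by (intro exI[of _ a] exI[of _ b]) simp
  moreover have "av132 R"
    unfolding subseq_no3
  proof (intro allI impI notI)
    fix x y z assume *: "subseq [x, y, z] R" "x < z \<and> z < y"
    have "subseq [a, x, y, z] (L @ R)" "a < x" "x < z" "z < y"
      using * abL abr[of x] subseq3_set[OF *(1)] by (simp_all add: subseq4_append)
    moreover from this have "bad4 a x y z" by (simp add: bad4_def)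
    ultimately show False using g(1) unfolding good_bad4 by blast
  qed
  moreover have "dec R" if fl: "subseq [False, True] (map (\<lambda>x. x < hd R) L)"
  proof (rule ccontr)
    assume "\<not> dec R"
    then obtain r s where rs: "subseq [r, s] R" "r < s" using not_dec_obtain[OF \<open>\<not> dec R\<close>] d by auto
    obtain x y where xy: "subseq [x, y] L" "\<not> x < hd R" "y < hd R"
      using fl by (auto simp: subseq2_map)
    have rsR: "r \<in> set R" "s \<in> set R" using subseq2D[OF rs(1)] by simp_all
    have xyL: "x \<in> set L" "y \<in> set L" using subseq2D[OF xy(1)] by simp_all
    have "y < r" using sides[OF xyL(2) rsR(1) h] xy by simp
    moreover have "s < x" using sides[OF xyL(1) rsR(2) h] xy rsR xyL d by (auto simp: not_less le_less)
    moreover have "subseq [x, y, r, s] (L @ R)" using xy rs by (simp add: subseq4_append)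
    moreover have "bad4 x y r s" using calculation rs(2) by (simp add: bad4_def)
    ultimately show False using g(1) unfolding good_bad4 by blast
  qed
  ultimately show ?thesis
    unfolding straddle_def using assms(4) sides[OF _ h] g(2) by blast
qed

text \<open>Every ascent of \<open>L\<close> leads from a small entry to a large one, so
  \<open>L\<close> contains no 123 and each of its ascents straddles \<open>R\<close>. An occurrence
  in \<open>L @ R\<close> is then refuted according to how many of its entries lie in
  \<open>L\<close>.\<close>

lemma straddle_good:
  assumes s: "straddle L R w" and d: "distinct (L @ R)" and lt: "\<And>x. x \<in> set (L @ R) \<Longrightarrow> x < N"
  shows "good (L @ N # R)" "\<not> dec L"
proof -
  have R: "R \<noteq> []" and w: "w = map (\<lambda>x. x < hd R) L"
    and sides: "\<And>x r. x \<in> set L \<Longrightarrow> r \<in> set R \<Longrightarrow> x < hd R \<longleftrightarrow> x < r"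
    and lo: "dec (filter (\<lambda>x. x < hd R) L)" and hi: "dec (filter (\<lambda>x. \<not> x < hd R) L)"
    and tf: "subseq [True, False] w" and av: "av123 R" "av132 R"
    and ft: "subseq [False, True] w \<longrightarrow> dec R"
    using s unfolding straddle_def by blast+
  have h: "hd R \<in> set R" using R by simp
  have asc: "x < hd R \<and> \<not> y < hd R" if "subseq [x, y] L" "x < y" for x y
    using that decD[OF lo, of x y] decD[OF hi, of x y]
    by (cases "x < hd R"; cases "y < hd R"; simp add: subseq2_filter)
  have up: "x < r" if "x \<in> set L" "x < hd R" "r \<in> set R" for x r using sides that by blast
  have down: "r < x" if "x \<in> set L" "\<not> x < hd R" "r \<in> set R" for x r
    using sides[of x r] that d by (auto simp: not_less le_less)
  have no3: False if "subseq [x, y, z] L" "x < y" "y < z" for x y z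
    using that asc[of x y] asc[of y z] subseq3D[of x y z L] by blast
  have "good (L @ R)"
    unfolding good_bad4
  proof (intro allI impI notI)
    fix a b c d assume "subseq [a, b, c, d] (L @ R)" and bad: "bad4 a b c d"
    then consider "subseq [a, b, c, d] L" | "subseq [a, b, c] L" "d \<in> set R" | "subseq [a, b] L" "subseq [c, d] R"
      | "a \<in> set L" "subseq [b, c, d] R" | "subseq [a, b, c, d] R"
      unfolding subseq4_append by blast
    then show False
    proof cases
      case 1
      then have "subseq [a, b, d] L" "subseq [a, b, c] L" "subseq [b, c, d] L" by (simp_all add: subseq4D)
      then show False using bad no3 unfolding bad4_def by blast
    next
      case 2
      then have "subseq [a, b] L" "subseq [b, c] L" "b \<in> set L" "c \<in> set L"
        using subseq3D[OF 2(1)] subseq3_set[OF 2(1)] by simp_all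
      then show False using bad no3[OF 2(1)] asc[of a b] asc[of b c] down[of b d] down[of c d] 2(2)
        unfolding bad4_def by auto
    next
      case 3
      have m: "a \<in> set L" "b \<in> set L" "c \<in> set R" "d \<in> set R" using subseq2D[OF 3(1)] subseq2D[OF 3(2)] by simp_all
      have "\<not> a < b"
        using asc[OF 3(1)] down[OF m(2) _ m(3)] down[OF m(2) _ m(4)] bad unfolding bad4_def by auto
      then have bad': "b < c" "c < d" "d < a" using bad unfolding bad4_def by auto
      then have "b < hd R" "\<not> a < hd R" using sides m by (metis less_asym)+
      then have "subseq [False, True] w" unfolding w subseq2_map using 3(1) by blast
      then have "dec R" using ft by blast
      then show False using decD[OF _ 3(2)] bad' by simp
    next
      case 4
      have m: "b \<in> set R" "c \<in> set R" "d \<in> set R" using subseq3_set[OF 4(2)] by simp_all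
      have "a < b \<longleftrightarrow> a < d" using sides[OF 4(1)] m by blast
      then show False using av123D[OF av(1) 4(2)] av132D[OF av(2) 4(2)] bad unfolding bad4_def by auto
    next
      case 5
      then have "subseq [a, b, d] R" "subseq [a, b, c] R" "subseq [b, c, d] R" by (simp_all add: subseq4D)
      then show False using bad av123D[OF av(1)] unfolding bad4_def by blast
    qed
  qed
  moreover have "a < r \<and> r < b" if "subseq [a, b] L" "a < b" "r \<in> set R" for a b r
    using asc[OF that(1,2)] up[of a r] down[of b r] subseq2D[OF that(1)] that(3) by blast
  ultimately show "good (L @ N # R)"
    using good_insert_max[OF d lt] av by blast
  obtain x y where "subseq [x, y] L" "x < hd R" "\<not> y < hd R"
    using tf unfolding w subseq2_map by auto
  then show "\<not> dec L" using decD[of L x y] by auto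
qed

text \<open>Each letter receives the number of equal letters from its place on, so both kinds
  decrease. The large values are shifted by \<open>c\<close>, which is chosen to leave room for the
  small values and for \<open>R\<close>.\<close>

fun merge_runs :: "nat \<Rightarrow> bool list \<Rightarrow> nat list" where
  "merge_runs c [] = []"
| "merge_runs c (b # w) =
     (if b then Suc (count_list w True) else Suc (c + count_list w False)) # merge_runs c w"

lemma length_merge_runs [simp]: "length (merge_runs c w) = length w"
  by (induction w) auto

lemma map_merge_runs: "count_list w True \<le> c \<Longrightarrow> map (\<lambda>x. x \<le> c) (merge_runs c w) = w"
  by (induction w) (auto split: if_splits)

lemma filter_merge_runs:
  assumes "count_list w True \<le> c"
  shows "filter (\<lambda>x. x \<le> c) (merge_runs c w) = rev [1..<Suc (count_list w True)]"
    and "filter (\<lambda>x. \<not> x \<le> c) (merge_runs c w) = rev [Suc c..<Suc (c + count_list w False)]"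
  using assms by (induction w) (auto split: if_splits)

lemma list_eq_filters:
  assumes "map P xs = map P ys" "filter P xs = filter P ys" "filter (\<lambda>x. \<not> P x) xs = filter (\<lambda>x. \<not> P x) ys"
  shows "xs = ys"
proof -
  have "length xs = length ys" using assms(1) by (rule map_eq_imp_length_eq)
  then show ?thesis using assms by (induction xs ys rule: list_induct2) (auto split: if_splits)
qed

lemma distinct_filters: "distinct (filter P xs) \<Longrightarrow> distinct (filter (\<lambda>x. \<not> P x) xs) \<Longrightarrow> distinct xs"
  by (induction xs) (auto split: if_splits)

lemma set_filters: "set xs = set (filter P xs) \<union> set (filter (\<lambda>x. \<not> P x) xs)"
  by auto

lemma count_list_bool: "count_list w True + count_list w False = length w"
  by (induction w) auto

definition straddle_params :: "(bool list \<times> nat list) set" where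
  "straddle_params = {(w, R). subseq [True, False] w \<and> R \<in> layered \<and> R \<noteq> [] \<and>
     (subseq [False, True] w \<longrightarrow> dec R)}"

definition straddle_perm :: "bool list \<times> nat list \<Rightarrow> nat list" where
  "straddle_perm = (\<lambda>(w, R). merge_runs (count_list w True + length R) w @
     Suc (length w + length R) # map ((+) (count_list w True)) R)"

text \<open>The factorisation around the maximum is unique, so incompatible conditions on
  \<open>L\<close> and \<open>R\<close> give disjoint families of permutations.\<close>

definition max_split_perms :: "(nat list \<Rightarrow> nat list \<Rightarrow> bool) \<Rightarrow> nat list set" where
  "max_split_perms P = {L @ Suc (length (L @ R)) # R | L R. L @ R \<in> perms \<and> P L R}"

lemma map_add_layered:
  "no3 (\<lambda>a b c. a < b \<and> b < c) (map ((+) (i :: nat)) R) \<longleftrightarrow> av123 R"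
  "no3 (\<lambda>a c b. a < b \<and> b < c) (map ((+) (i :: nat)) R) \<longleftrightarrow> av132 R"
  by (simp_all add: no3_map)

text \<open>The values are stacked as small entries of \<open>L\<close>, then \<open>R\<close>, then
  large entries of \<open>L\<close>, with \<open>c\<close> the largest value of
  \<open>R\<close>.\<close>

lemma straddle_perm_split:
  assumes "(w, R') \<in> straddle_params"
  defines "l \<equiv> count_list w True" and "c \<equiv> count_list w True + length R'"
  defines "L \<equiv> merge_runs c w" and "R \<equiv> map ((+) l) R'"
  shows "straddle L R w" "L @ R \<in> perms" "length L = length w" "length R = length R'"
proof -
  have R': "R' \<in> perms" "av123 R'" "av132 R'" "R' \<noteq> []"
    and w: "subseq [True, False] w" "subseq [False, True] w \<longrightarrow> dec R'"
    using assms(1) by (auto simp: straddle_params_def layered_def)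
  have lc: "count_list w True \<le> c" by (simp add: c_def)
  note f = filter_merge_runs[OF lc]
  have setL: "set L = {1..l} \<union> {Suc c..c + count_list w False}"
    unfolding L_def l_def set_filters[of "merge_runs c w" "\<lambda>x. x \<le> c"] f set_rev set_upt by auto
  have setR: "set R = {Suc l..c}"
  proof -
    have "set R = (+) l ` {1..length R'}" using R'(1) by (simp add: R_def perms_def)
    then show ?thesis by (simp add: c_def l_def add.commute)
  qed
  have "R \<noteq> []" using R' by (simp add: R_def)
  then have h: "hd R \<in> set R" by simp
  have lohi: "x < r \<longleftrightarrow> x \<le> c" if "x \<in> set L" "r \<in> set R" for x r
    using that lc unfolding setL setR by (auto simp: l_def)
  have "filter (\<lambda>x. x < hd R) L = filter (\<lambda>x. x \<le> c) L" "filter (\<lambda>x. \<not> x < hd R) L = filter (\<lambda>x. \<not> x \<le> c) L"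
    "map (\<lambda>x. x < hd R) L = map (\<lambda>x. x \<le> c) L"
    using lohi[OF _ h] by (auto intro!: filter_cong)
  moreover have "map (\<lambda>x. x \<le> c) L = w" unfolding L_def by (rule map_merge_runs[OF lc])
  moreover have "av123 R" "av132 R" "dec R \<longleftrightarrow> dec R'"
    using R' unfolding R_def by (simp_all add: map_add_layered)
  moreover have "x < hd R \<longleftrightarrow> x < r" if "x \<in> set L" "r \<in> set R" for x r
    using lohi[OF that(1)] h that(2) by blast
  ultimately show "straddle L R w"
    unfolding straddle_def using \<open>R \<noteq> []\<close> w f[folded L_def] by (simp del: upt_Suc)
  show len: "length L = length w" "length R = length R'" by (simp_all add: L_def R_def)
  have "distinct L"
    by (rule distinct_filters[of "\<lambda>x. x \<le> c"]) (simp_all add: L_def f del: upt_Suc)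
  moreover have "distinct R" using R' by (simp add: R_def distinct_map perms_def)
  moreover have "set L \<inter> set R = {}" unfolding setL setR by auto
  moreover have "set L \<union> set R = {1..length L + length R}"
    using lc count_list_bool[of w] unfolding setL setR len c_def l_def by auto
  ultimately show "L @ R \<in> perms" by (simp add: perms_def)
qed

lemma straddle_perms_eq:
  "max_split_perms (\<lambda>L R. good (L @ Suc (length (L @ R)) # R) \<and> R \<noteq> [] \<and> \<not> dec L) =
   straddle_perm ` straddle_params"
proof (intro equalityI subsetI)
  fix p assume "p \<in> straddle_perm ` straddle_params"
  then obtain w R' where wR: "p = straddle_perm (w, R')" "(w, R') \<in> straddle_params" by auto
  define L where "L = merge_runs (count_list w True + length R') w"
  define R where "R = map ((+) (count_list w True)) R'"
  note s = straddle_perm_split[OF wR(2), folded L_def R_def]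
  have p: "p = L @ Suc (length (L @ R)) # R"
    by (simp add: wR straddle_perm_def L_def R_def)
  have "good p" "\<not> dec L"
    unfolding p using straddle_good[OF s(1) _ perms_lessD[OF s(2)]] s(2) by (simp_all add: perms_def)
  moreover have "R \<noteq> []" using s(1) by (simp add: straddle_def)
  ultimately show "p \<in> max_split_perms (\<lambda>L R. good (L @ Suc (length (L @ R)) # R) \<and> R \<noteq> [] \<and> \<not> dec L)"
    using s(2) p unfolding max_split_perms_def by blast
next
  fix p assume "p \<in> max_split_perms (\<lambda>L R. good (L @ Suc (length (L @ R)) # R) \<and> R \<noteq> [] \<and> \<not> dec L)"
  then obtain L R where p: "p = L @ Suc (length (L @ R)) # R" and LR: "L @ R \<in> perms"
    and g: "good (L @ Suc (length (L @ R)) # R)" "R \<noteq> []" "\<not> dec L"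
    unfolding max_split_perms_def by blast
  define w where "w = map (\<lambda>x. x < hd R) L"
  have d: "distinct (L @ R)" "set (L @ R) = {1..<Suc (length (L @ R))}"
    using LR by (simp_all add: perms_def atLeastLessThanSuc_atLeastAtMost)
  have s: "straddle L R w"
    unfolding w_def using straddleI[OF g(1) d(1) perms_lessD[OF LR] g(2,3)] by blast
  define lo hi where "lo = filter (\<lambda>x. x < hd R) L" and "hi = filter (\<lambda>x. \<not> x < hd R) L"
  have side: "x < hd R \<longleftrightarrow> x < r" if "x \<in> set L" "r \<in> set R" for x r
    using s that unfolding straddle_def by blast
  have dec: "dec lo" "dec hi" using s unfolding straddle_def lo_def hi_def by blast+
  have h: "hd R \<in> set R" using g by simp
  have lR: "x < r" if "x \<in> set lo" "r \<in> set R" for x r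
    using side[of x r] that by (simp add: lo_def)
  have Rh: "r < x" if "x \<in> set hi" "r \<in> set R" for x r
    using side[of x r] that d(1) by (auto simp: hi_def not_less le_less)
  have set: "set lo \<union> set (R @ hi) = {1..<Suc (length (L @ R))}" "distinct lo" "distinct (R @ hi)"
    using d by (auto simp: lo_def hi_def)
  have lRh: "x < y" if "x \<in> set lo" "y \<in> set (R @ hi)" for x y
    using that lR[OF that(1) h] lR[OF that(1)] Rh[OF _ h] by fastforce
  \<comment> \<open>By value the blocks are ordered \<open>lo\<close>, \<open>R\<close>,
    \<open>hi\<close>; two cuts turn each of them into an interval.\<close>
  note 1 = upt_split[OF set lRh]
  have 2: "set R = {1 + length lo..<1 + length lo + length R}"
    "set hi = {1 + length lo + length R..<Suc (length (L @ R))}"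
    using upt_split[of R hi "1 + length lo"] 1(2) set(3) Rh by auto
  obtain R' where R': "R' \<in> perms" "R = map ((+) (length lo)) R'"
    using perms_shift[OF 2(1)] d(1) by auto
  have l: "length lo = count_list w True"
    unfolding lo_def w_def by (induction L) auto
  have lhi: "length hi = count_list w False"
    unfolding hi_def w_def by (induction L) auto
  \<comment> \<open>This is the largest value of \<open>R\<close>, so comparing with
    \<open>c\<close> separates the small from the large entries of \<open>L\<close> just as
    comparing with \<open>hd R\<close> does.\<close>
  define c where "c = count_list w True + length R"
  have Pc: "x \<le> c \<longleftrightarrow> x < hd R" if "x \<in> set L" for x
  proof (cases "x < hd R")
    case True
    then have "x \<in> set lo" using that by (simp add: lo_def)
    then show ?thesis using True 1(1) l by (auto simp: c_def)
  next
    case False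
    then have "x \<in> set hi" using that by (simp add: hi_def)
    then show ?thesis using False 2(2) l by (auto simp: c_def)
  qed
  have L: "merge_runs c w = L"
  proof (rule list_eq_filters[symmetric])
    have lc: "count_list w True \<le> c" by (simp add: c_def)
    show "map (\<lambda>x. x \<le> c) L = map (\<lambda>x. x \<le> c) (merge_runs c w)"
      unfolding map_merge_runs[OF lc] unfolding w_def using Pc by simp
    have "filter (\<lambda>x. x \<le> c) L = lo" unfolding lo_def using Pc by (intro filter_cong) auto
    also have "\<dots> = rev [1..<1 + length lo]" by (rule dec_eq_rev_upt[OF dec(1) 1(1)])
    finally show "filter (\<lambda>x. x \<le> c) L = filter (\<lambda>x. x \<le> c) (merge_runs c w)"
      unfolding filter_merge_runs(1)[OF lc] l by simp
    have "filter (\<lambda>x. \<not> x \<le> c) L = hi" unfolding hi_def using Pc by (intro filter_cong) auto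
    also have "\<dots> = rev [1 + length lo + length R..<Suc (length (L @ R))]"
      by (rule dec_eq_rev_upt[OF dec(2) 2(2)])
    also have "length (L @ R) = c + count_list w False"
      using count_list_bool[of w] by (simp add: c_def w_def)
    finally show "filter (\<lambda>x. \<not> x \<le> c) L = filter (\<lambda>x. \<not> x \<le> c) (merge_runs c w)"
      unfolding filter_merge_runs(2)[OF lc] l by (simp add: c_def)
  qed
  have "length w = length L" by (simp add: w_def)
  moreover have "length R' = length R" using arg_cong[OF R'(2), of length] by simp
  moreover have "map ((+) (count_list w True)) R' = R" using R'(2) l by simp
  ultimately have "p = straddle_perm (w, R')"
    unfolding p straddle_perm_def using L by (simp add: c_def)
  moreover have "(w, R') \<in> straddle_params"
  proof -
    have "av123 R'" "av132 R'" "dec R \<longleftrightarrow> dec R'" "R' \<noteq> []"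
      using s g(2) unfolding straddle_def R'(2) map_add_layered by simp_all
    then show ?thesis
      using s R'(1) unfolding straddle_def straddle_params_def layered_def by auto
  qed
  ultimately show "p \<in> straddle_perm ` straddle_params" by blast
qed

lemma inj_straddle_perm: "inj_on straddle_perm straddle_params"
proof (rule inj_onI, clarify)
  fix w R w' R'
  assume wR: "(w, R) \<in> straddle_params" "(w', R') \<in> straddle_params"
    and eq: "straddle_perm (w, R) = straddle_perm (w', R')"
  define L1 where "L1 = merge_runs (count_list w True + length R) w"
  define R1 where "R1 = map ((+) (count_list w True)) R"
  define L2 where "L2 = merge_runs (count_list w' True + length R') w'"
  define R2 where "R2 = map ((+) (count_list w' True)) R'"
  note s = straddle_perm_split[OF wR(1), folded L1_def R1_def]
    and s' = straddle_perm_split[OF wR(2), folded L2_def R2_def]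
  let ?N = "Suc (length w + length R)"
  have "length (straddle_perm (w, R)) = length (straddle_perm (w', R'))" using eq by simp
  then have N: "length w + length R = length w' + length R'" by (simp add: straddle_perm_def)
  have "L1 @ ?N # R1 = L2 @ ?N # R2"
    using eq N by (simp add: straddle_perm_def L1_def R1_def L2_def R2_def)
  moreover have "?N \<notin> set (L1 @ R1)" "?N \<notin> set (L2 @ R2)"
    using perms_lessD[OF s(2)] perms_lessD[OF s'(2)] s(3,4) s'(3,4) N by fastforce+
  ultimately have e: "L1 = L2" "R1 = R2" by (auto simp: append_Cons_eq_iff)
  then have w: "w = w'" using s(1) s'(1) unfolding straddle_def by simp
  then have "R = R'" using e(2) unfolding R1_def R2_def by (simp add: inj_map_eq_map)
  then show "w = w' \<and> R = R'" using w by simp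
qed

section \<open>Counting the straddling permutations\<close>

lemma subseq_two_runs:
  "{w. subseq [True, False] w} = UNIV - {w. sorted w}"
  "{w. subseq [True, False] w \<and> \<not> subseq [False, True] w} =
     (\<lambda>(a, b). replicate (Suc a) True @ replicate (b + 1) False) ` UNIV"
proof -
  have s: "sorted w \<longleftrightarrow> \<not> subseq [True, False] w" for w
  proof -
    have "sorted w \<longleftrightarrow> (\<forall>a b. subseq [a, b] w \<longrightarrow> a \<le> b)"
      by (induction w) (auto simp: subseq2_Cons)
    also have "\<dots> \<longleftrightarrow> \<not> subseq [True, False] w"
      unfolding le_bool_def by (metis (full_types))
    finally show ?thesis .
  qed
  then show "{w. subseq [True, False] w} = UNIV - {w. sorted w}" by auto
  \<comment> \<open>Complementing all letters reduces the absence of \<open>False\<close> before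
    \<open>True\<close> to sortedness.\<close>
  have neg: "subseq [False, True] w \<longleftrightarrow> subseq [True, False] (map Not w)" for w
    by (auto simp: subseq2_map)
  have r: "subseq [True, False] (replicate a True @ replicate b False) \<longleftrightarrow> a > 0 \<and> b > 0"
      "\<not> subseq [False, True] (replicate a True @ replicate b False)" for a b
    using subseq2D[of _ _ "replicate a _"] subseq2D[of _ _ "replicate b _"]
    by (auto simp: subseq2_append dest: subseq2D)
  show "{w. subseq [True, False] w \<and> \<not> subseq [False, True] w} =
     (\<lambda>(a, b). replicate (Suc a) True @ replicate (b + 1) False) ` UNIV"
  proof (intro equalityI subsetI)
    fix w assume w: "w \<in> {w. subseq [True, False] w \<and> \<not> subseq [False, True] w}"
    then have "map Not w \<in> {w. sorted w}" using s neg by simp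
    then obtain a b where "map Not w = replicate a False @ replicate b True"
      unfolding sorted_bools by auto
    then have "map Not (map Not w) = replicate a True @ replicate b False" by simp
    then have "w = replicate a True @ replicate b False" by (simp add: comp_def)
    moreover from this have "a > 0" "b > 0" using w r(1) by auto
    ultimately have "w = replicate (Suc (a - 1)) True @ replicate ((b - 1) + 1) False" by simp
    then have "w = (\<lambda>(a, b). replicate (Suc a) True @ replicate (b + 1) False) (a - 1, b - 1)" by simp
    then show "w \<in> (\<lambda>(a, b). replicate (Suc a) True @ replicate (b + 1) False) ` UNIV" by (rule range_eqI)
  qed (use r in \<open>auto simp del: replicate_Suc\<close>)
qed

lemma decreasing_subset_layered: "decreasing \<subseteq> layered"
  by (auto simp: decreasing_def layered_def intro: dec_no3)

lemma has_gf_layered_diff: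
  "has_gf (layered - decreasing) length ((1 - fps_X) * inverse (1 - 2 * fps_X) - inverse (1 - fps_X))"
  by (rule has_gf_Diff[OF has_gf_layered has_gf_decreasing decreasing_subset_layered])

lemma has_gf_decreasing_nonempty:
  "has_gf (decreasing - {[]}) length (fps_X * inverse (1 - fps_X))"
proof -
  have "has_gf (decreasing - {[]}) length (inverse (1 - fps_X) - fps_X ^ length ([] :: nat list))"
    by (rule has_gf_Diff[OF has_gf_decreasing has_gf_singleton]) (simp add: decreasing_def)
  moreover have "inverse (1 - fps_X) - 1 = fps_X * inverse (1 - fps_X :: real fps)"
    using inverse_one_minus_X by (simp add: algebra_simps)
  ultimately show ?thesis by simp
qed

text \<open>Either \<open>R\<close> is decreasing and nonempty and \<open>w\<close> is any unsorted
  word, or \<open>R\<close> is layered but not decreasing, hence nonempty, and \<open>w\<close>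
  consists of a run of \<open>True\<close> and a run of \<open>False\<close>, both nonempty. The
  outer factor is the maximum.\<close>

lemma has_gf_straddle:
  fixes g h :: "real fps"
  defines "g \<equiv> inverse (1 - fps_X)" and "h \<equiv> inverse (1 - 2 * fps_X)"
  shows "has_gf (straddle_perm ` straddle_params) length
    (fps_X * ((h - g * g) * (fps_X * g) + fps_X\<^sup>2 * (g * g) * ((1 - fps_X) * h - g)))"
proof -
  let ?W = "{w. subseq [True, False] w}"
  let ?V = "{w. subseq [True, False] w \<and> \<not> subseq [False, True] w}"
  have "has_gf ?W length (h - g * g)"
    unfolding subseq_two_runs(1) g_def h_def
    by (rule has_gf_Diff[OF has_gf_words has_gf_sorted_bools]) simp
  moreover have "has_gf ?V length (fps_X ^ Suc 1 * (g * g))"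
    unfolding subseq_two_runs(2) g_def h_def by (rule has_gf_Suc_runs) simp
  ultimately have "has_gf (?W \<times> (decreasing - {[]}) \<union> ?V \<times> (layered - decreasing)) (\<lambda>(w, R). length w + length R)
      ((h - g * g) * (fps_X * g) + fps_X ^ Suc 1 * (g * g) * ((1 - fps_X) * h - g))"
    using has_gf_decreasing_nonempty has_gf_layered_diff unfolding g_def h_def
    by (intro has_gf_Un has_gf_times) auto
  moreover have "?W \<times> (decreasing - {[]}) \<union> ?V \<times> (layered - decreasing) = straddle_params"
    using decreasing_subset_layered
    by (auto simp: straddle_params_def decreasing_def layered_def)
  ultimately have "has_gf straddle_params (\<lambda>(w, R). length w + length R)
      ((h - g * g) * (fps_X * g) + fps_X ^ Suc 1 * (g * g) * ((1 - fps_X) * h - g))" by simp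
  from has_gf_image[OF this inj_straddle_perm, of length 1]
  show ?thesis by (simp add: straddle_perm_def case_prod_beta power2_eq_square)
qed

section \<open>Decreasing before the maximum\<close>

text \<open>Here \<open>R = D @ X @ A @ T # Y\<close>, where \<open>T\<close> is the top of the first ascent above \<open>last L\<close>. The entries
  before \<open>T\<close> are decreasing: those of \<open>D\<close> are above \<open>T\<close>, those of \<open>A\<close> are below \<open>last L\<close>.\<close>

definition hooked :: "nat list \<Rightarrow> nat list \<Rightarrow> nat list \<Rightarrow> nat list \<Rightarrow> nat \<Rightarrow> nat list \<Rightarrow> bool" where
  "hooked L D X A T Y \<longleftrightarrow> L \<noteq> [] \<and> X \<noteq> [] \<and> dec L \<and> dec (D @ X @ A) \<and>
     (\<forall>a\<in>set A. \<forall>z\<in>set L \<union> set X \<union> set Y. a < z) \<and>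
     (\<forall>z\<in>set L \<union> set X \<union> set Y. z < T) \<and> (\<forall>d\<in>set D. T < d) \<and>
     (\<forall>x\<in>set X. \<forall>y\<in>set Y. y < x) \<and> (\<forall>z\<in>set X \<union> set Y. last L < z) \<and>
     av123 Y \<and> av132 Y \<and>
     (Y \<noteq> [] \<longrightarrow> (\<forall>l\<in>set L. (\<forall>y\<in>set Y. l < y) \<or> (\<forall>x\<in>set X. x < l))) \<and>
     (A \<noteq> [] \<or> (\<exists>l\<in>set L. \<exists>y\<in>set Y. y < l) \<longrightarrow> dec Y)"

lemma dec_last_le: "dec L \<Longrightarrow> l \<in> set L \<Longrightarrow> last L \<le> l"
  by (induction L) (auto dest: bspec[OF _ last_in_set])

lemma subseq3_tail: "subseq [a, b, c] (U @ T # Y) \<Longrightarrow> a \<notin> set U \<Longrightarrow> a \<noteq> T \<Longrightarrow> subseq [a, b, c] Y"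
  using subseq3_set[of a b c U] subseq2D[of a b U] unfolding subseq3_append subseq3_Cons by blast

text \<open>The ascents of \<open>R\<close> are of three kinds: ending in \<open>T\<close>, from
  \<open>A\<close> into \<open>Y\<close>, or inside \<open>Y\<close>. Two of them can be chained to
  a 123 only within \<open>Y\<close>, or from \<open>A\<close> into an ascent of \<open>Y\<close>;
  the conditions on \<open>Y\<close> exclude both.\<close>

lemma hooked_good:
  assumes h: "hooked L D X A T Y" and d: "distinct (L @ D @ X @ A @ T # Y)"
    and lt: "\<And>x. x \<in> set (L @ D @ X @ A @ T # Y) \<Longrightarrow> x < N"
  shows "good (L @ N # D @ X @ A @ T # Y)" "\<not> av123 (L @ N # D @ X @ A @ T # Y)"
proof -
  define U where "U = D @ X @ A"
  define R where "R = U @ T # Y"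
  have R: "D @ X @ A @ T # Y = R" by (simp add: R_def U_def)
  have ne: "L \<noteq> []" "X \<noteq> []" and dL: "dec L" and dU: "dec U" and av: "av123 Y" "av132 Y"
    and A: "\<forall>a\<in>set A. \<forall>z\<in>set L \<union> set X \<union> set Y. a < z"
    and T: "\<forall>z\<in>set L \<union> set X \<union> set Y. z < T" and D: "\<forall>d\<in>set D. T < d"
    and XY: "\<forall>x\<in>set X. \<forall>y\<in>set Y. y < x" and last: "\<forall>z\<in>set X \<union> set Y. last L < z"
    and gap: "Y \<noteq> [] \<longrightarrow> (\<forall>l\<in>set L. (\<forall>y\<in>set Y. l < y) \<or> (\<forall>x\<in>set X. x < l))"
    and dY: "A \<noteq> [] \<or> (\<exists>l\<in>set L. \<exists>y\<in>set Y. y < l) \<longrightarrow> dec Y"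
    using h unfolding U_def hooked_def by - (elim conjE, assumption)+
  have A: "a < z" if "a \<in> set A" "z \<in> set L \<union> set X \<union> set Y" for a z using A that by blast
  have T: "z < T" if "z \<in> set L \<union> set X \<union> set Y" for z using T that by blast
  have D: "T < e" if "e \<in> set D" for e using D that by blast
  have XY: "y < x" if "x \<in> set X" "y \<in> set Y" for x y using XY that by blast
  have last: "last L < z" if "z \<in> set X \<union> set Y" for z using last that by blast
  have gap: "l < y \<or> x < l" if "l \<in> set L" "x \<in> set X" "y \<in> set Y" for l x y
    using gap that by (cases "Y = []") auto
  have U_lt: "u \<in> set A" if "u \<in> set U" "u < y" "y \<in> set Y" for u y
    using that D[of u] T[of y] XY[of u y] by (auto simp: U_def)
  have asc: "b \<in> set U \<and> c = T \<or> b \<in> set A \<and> c \<in> set Y \<or> subseq [b, c] Y" if "subseq [b, c] R" "b < c" for b c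
  proof -
    have "\<not> subseq [b, c] U" using decD[OF dU] that(2) by fastforce
    moreover have "\<not> (b = T \<and> c \<in> set Y)" using T[of c] that(2) by auto
    ultimately show ?thesis
      using that U_lt[of b c] unfolding R_def subseq2_append subseq2_Cons by auto
  qed
  have avR: "av123 R"
    unfolding subseq_no3
  proof (intro allI impI notI)
    fix a b c assume s: "subseq [a, b, c] R" and l: "a < b \<and> b < c"
    have bc: "subseq [a, b] R" "subseq [b, c] R" using subseq3D[OF s] by simp_all
    have cm: "c \<in> set R" using subseq2D[OF bc(2)] by simp
    have "b \<in> set U \<and> c = T \<or> b \<in> set A \<and> c \<in> set Y \<or> subseq [b, c] Y" using asc bc l by blast
    then show False
    proof (elim disjE conjE)
      assume "b \<in> set U" "c = T"
      then have "b \<notin> set Y" "b \<noteq> T" using d l by (auto simp: U_def)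
      then have False if "subseq [a, b] Y" using subseq2D[OF that] by blast
      then show False using asc[OF bc(1)] l \<open>b \<notin> set Y\<close> \<open>b \<noteq> T\<close> by blast
    next
      assume b: "b \<in> set A" "c \<in> set Y"
      then have "b \<notin> set Y" "b \<noteq> T" using d by auto
      then have False if "subseq [a, b] Y" using subseq2D[OF that] by blast
      then show False using asc[OF bc(1)] l \<open>b \<notin> set Y\<close> \<open>b \<noteq> T\<close> by blast
    next
      assume bcY: "subseq [b, c] Y"
      then have bY: "b \<in> set Y" "c \<in> set Y" using subseq2D[OF bcY] by simp_all
      then have "b \<noteq> T" "b \<notin> set U" using d by (auto simp: U_def)
      then consider "a \<in> set A" | "subseq [a, b] Y" using asc[OF bc(1)] l by blast
      then show False
      proof cases
        case 1
        then have "dec Y" using dY by auto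
        then show False using decD[OF _ bcY] l by simp
      next
        case 2
        then have "a \<in> set Y" using subseq2D[OF 2] by simp
        then have "a \<notin> set U" "a \<noteq> T" using d by (auto simp: U_def)
        then have "subseq [a, b, c] Y" using subseq3_tail[OF s[unfolded R_def]] by blast
        then show False using av123D[OF av(1)] l by blast
      qed
    qed
  qed
  \<comment> \<open>Above an entry of \<open>L\<close> only two kinds of ascents remain, because
    \<open>A\<close> lies below \<open>L\<close> and \<open>D\<close> lies above
    \<open>T\<close>.\<close>
  have ascL: "b \<in> set X \<and> c = T \<or> subseq [b, c] Y" if "subseq [b, c] R" "b < c" "l \<in> set L" "l < b" for b c l
    using asc[OF that(1,2)] A[of b l] D[of b] that by (auto simp: U_def)
  have distR: "distinct (L @ R)" using d R by simp
  have ltR: "x < N" if "x \<in> set (L @ R)" for x using lt that R by simp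
  have "good (L @ R)"
    unfolding good_bad4
  proof (intro allI impI notI)
    fix a b c e assume "subseq [a, b, c, e] (L @ R)" and bad: "bad4 a b c e"
    \<comment> \<open>Occurrences with three or four entries in \<open>L\<close> are treated
      together: all three patterns have an ascent among their first three entries.\<close>
    then consider "subseq [a, b, c] L" | "subseq [a, b] L" "subseq [c, e] R"
      | "a \<in> set L" "subseq [b, c, e] R" | "subseq [a, b, c, e] R"
      unfolding subseq4_append using subseq4D[of a b c e L] by blast
    then show False
    proof cases
      case 1
      then have "b < a" "c < b" using decD[OF dL, of a b] decD[OF dL, of b c] subseq3D[OF 1] by simp_all
      then show False using bad unfolding bad4_def by auto
    next
      case 2
      then have ab: "b < a" "a \<in> set L" "b \<in> set L" using decD[OF dL 2(1)] subseq2D[OF 2(1)] by simp_all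
      then have bad': "b < c" "c < e" "e < a" using bad unfolding bad4_def by auto
      have "e \<noteq> T" using T[of a] ab bad' by auto
      then have ce: "subseq [c, e] Y" using ascL[OF 2(2) bad'(2) ab(3) bad'(1)] by blast
      then have "c \<in> set Y" using subseq2D[OF ce] by blast
      then have "dec Y" using dY ab bad' by (meson less_trans)
      then show False using decD[OF _ ce] bad' by simp
    next
      case 3
      have be: "subseq [b, c] R" "subseq [c, e] R" "e \<in> set R" "subseq [b, e] R"
        using subseq3D[OF 3(2)] subseq3_set[OF 3(2)] by simp_all
      have "\<not> (b < c \<and> c < e)" using av123D[OF avR 3(2)] by blast
      then have cases: "a < b \<and> b < e \<and> e < c \<or> e < a \<and> a < b \<and> b < c" using bad unfolding bad4_def by auto
      then have lt: "a < b" "b < c" by auto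
      then consider "b \<in> set X" "c = T" | "subseq [b, c] Y" using ascL[OF be(1) lt(2) 3(1) lt(1)] by blast
      then show False
      proof cases
        case 1
        then have "e \<in> set Y"
          using be(2) d subseq2D[of T e U] subseq2D[of T e Y] unfolding R_def subseq2_append subseq2_Cons
          by (auto simp: U_def)
        then show False using cases XY[of b e] gap[OF 3(1), of b e] 1 by auto
      next
        case 2
        then have bcY: "b \<in> set Y" "c \<in> set Y" using subseq2D[OF 2] by simp_all
        then have "b \<notin> set U" "b \<noteq> T" using d by (auto simp: U_def)
        then have s: "subseq [b, c, e] Y" using subseq3_tail[OF 3(2)[unfolded R_def]] by blast
        then have "e \<in> set Y" using subseq3_set[OF s] by blast
        then have "e < a \<longrightarrow> dec Y" using dY 3(1) by blast
        then show False using cases decD[OF _ 2] av132D[OF av(2) s] by auto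
      qed
    next
      case 4
      then have "subseq [a, b, c] R" "subseq [b, c, e] R" "subseq [a, b, e] R" by (simp_all add: subseq4D)
      then show False using bad av123D[OF avR] unfolding bad4_def by blast
    qed
  qed
  moreover have False if "subseq [a, b] L" "a < b" for a b using decD[OF dL that(1)] that(2) by simp
  ultimately show "good (L @ N # D @ X @ A @ T # Y)"
    unfolding R using good_insert_max[OF distR ltR] avR by blast
  obtain x where x: "x \<in> set X" using ne by (cases X) auto
  then have "subseq [last L, x, T] (L @ N # R)"
    using ne by (simp add: subseq3_append subseq3_Cons subseq2_Cons subseq2_append R_def U_def)
  moreover have "last L < x" "x < T" using last T x by simp_all
  ultimately show "\<not> av123 (L @ N # D @ X @ A @ T # Y)" unfolding R subseq_no3 by blast
qed

section \<open>Decomposition around the top of the first ascent\<close>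

lemma first_prefix:
  assumes "Q xs" "\<not> Q []"
  obtains u t v where "xs = u @ t # v" "\<not> Q u" "Q (u @ [t])"
  using assms
proof (induction xs arbitrary: thesis rule: rev_induct)
  case (snoc x xs)
  show ?case
  proof (cases "Q xs")
    case True
    then obtain u t v where "xs = u @ t # v" "\<not> Q u" "Q (u @ [t])" using snoc.IH snoc.prems(3) by blast
    then show ?thesis using snoc.prems(1)[of u t "v @ [x]"] by simp
  next
    case False
    then show ?thesis using snoc.prems(1)[of xs x "[]"] snoc.prems(2) by simp
  qed
qed simp

lemma dec_partition:
  assumes "dec u" "m < T" "m \<notin> set u" "T \<notin> set u"
  shows "u = filter (\<lambda>x. T < x) u @ filter (\<lambda>x. m < x \<and> x < T) u @ filter (\<lambda>x. x < m) u"
proof (rule dec_eqI)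
  show "dec (filter (\<lambda>x. T < x) u @ filter (\<lambda>x. m < x \<and> x < T) u @ filter (\<lambda>x. x < m) u)"
    using assms(1,2) by (auto simp: dec_append sorted_wrt_filter)
  have "x < m \<or> m < x \<and> x < T \<or> T < x" if "x \<in> set u" for x
    using assms that by (metis linorder_neqE_nat)
  then show "set u = set (filter (\<lambda>x. T < x) u @ filter (\<lambda>x. m < x \<and> x < T) u @ filter (\<lambda>x. x < m) u)"
    by auto
qed (fact assms)

text \<open>With \<open>m = last L\<close> and \<open>x0\<close> in \<open>X\<close>, each condition
  excludes one occurrence: \<open>m x0 T y\<close> with \<open>y < m\<close> is 2341,
  \<open>x0 T y\<close> with \<open>T < y\<close> is a 123 in \<open>R\<close>,
  \<open>m x T y\<close> with \<open>x < y < T\<close> is 1243, \<open>l m x0 T\<close> with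
  \<open>T < l\<close> is 4123, and \<open>l x T y\<close> with \<open>y < l < x\<close> is 2341. An
  ascent \<open>y1 y2\<close> of \<open>Y\<close> forms a 123 in \<open>R\<close> after an entry of
  \<open>A\<close>, and a 4123 after \<open>l m\<close> if \<open>l\<close> exceeds both.\<close>

lemma hookedI:
  assumes good: "good (L @ N # R)" and d: "distinct (L @ R)" and lt: "\<And>x. x \<in> set (L @ R) \<Longrightarrow> x < N"
    and dL: "dec L" and n123: "\<not> av123 (L @ N # R)"
  obtains D X A T Y where "R = D @ X @ A @ T # Y" "hooked L D X A T Y"
proof -
  have gLR: "good (L @ R)" and avR: "av123 R"
    using good_insert_max[OF d lt] good by blast+
  have no4: False if "subseq [a, b, c, e] (L @ R)" "bad4 a b c e" for a b c e
    using gLR that unfolding good_bad4 by blast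
  have no3: False if "subseq [a, b, c] R" "a < b" "b < c" for a b c
    using av123D[OF avR] that by blast
  \<comment> \<open>A 123 containing \<open>N\<close> would need an ascent of \<open>L\<close>
    before it, and \<open>R\<close> has no 123. So exactly one entry lies in \<open>L\<close>, and
    an ascent of \<open>R\<close> lies above it.\<close>
  obtain l0 r1 r2 where r: "l0 \<in> set L" "subseq [r1, r2] R" "l0 < r1" "r1 < r2"
  proof -
    obtain a b c where s: "subseq [a, b, c] (L @ N # R)" "a < b" "b < c"
      using n123 unfolding subseq_no3 by blast
    have "\<not> subseq [a, b] L" "\<not> subseq [a, b, c] L" using decD[OF dL, of a b] s(2) subseq3D[of a b c L] by auto
    moreover have "b \<noteq> N" "a \<noteq> N"
      using s subseq3_set[OF s(1)] lt[of b] lt[of c] by auto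
    moreover have "\<not> subseq [a, b, c] R" using no3 s by blast
    ultimately have "a \<in> set L" "subseq [b, c] R"
      using s(1) unfolding subseq3_append subseq3_Cons subseq2_Cons by blast+
    then show thesis using that s by blast
  qed
  have neL: "L \<noteq> []" using r by auto
  define m where "m = last L"
  have mL: "m \<in> set L" using neL by (simp add: m_def)
  have m_le: "m \<le> l" if "l \<in> set L" for l using dec_last_le[OF dL that] by (simp add: m_def)
  have lm: "subseq [l, m] L" if "l \<in> set L" "l \<noteq> m" for l
    using subseq2_total[OF that(1) mL that(2)] decD[OF dL, of m l] m_le[OF that(1)] by auto
  have mr: "m < r1" using m_le[OF r(1)] r(3) by simp
  have m1: "subseq [m, a, b, c] (L @ R)" if "subseq [a, b, c] R" for a b c
    using that mL by (simp add: subseq4_append)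
  \<comment> \<open>Only entries above \<open>m\<close> are inspected: smaller entries of
    \<open>R\<close> may precede \<open>T\<close> and will form \<open>A\<close>.\<close>
  define Q where "Q xs \<longleftrightarrow> \<not> dec (filter (\<lambda>x. m < x) xs)" for xs
  have "subseq [r1, r2] (filter (\<lambda>x. m < x) R)" using r mr by (simp add: subseq2_filter)
  then have "Q R" unfolding Q_def using decD[of "filter (\<lambda>x. m < x) R" r1 r2] r(4) by auto
  moreover have "\<not> Q []" by (simp add: Q_def)
  ultimately obtain u T Y where R: "R = u @ T # Y" and u: "\<not> Q u" "Q (u @ [T])" by (rule first_prefix)
  have du: "dec (filter (\<lambda>x. m < x) u)" using u(1) by (simp add: Q_def)
  have nd: "\<not> dec (filter (\<lambda>x. m < x) u @ (if m < T then [T] else []))"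
    using u(2) by (simp add: Q_def split: if_splits)
  then have mT: "m < T" using du by (auto split: if_splits)
  then obtain x0 where x0: "x0 \<in> set u" "m < x0" "x0 < T"
    using nd du d R by (auto simp: dec_append) (metis linorder_neqE_nat)
  have T_notin: "T \<notin> set u" "T \<notin> set Y" "T \<notin> set L" and m_notin: "m \<notin> set u" "m \<notin> set Y"
    using d R mL by auto
  have xT: "subseq [x, T, y] R" if "x \<in> set u" "y \<in> set Y" for x y
    using that by (simp add: R subseq3_append subseq2_Cons)
  have Ym: "m < y" if y: "y \<in> set Y" for y
  proof (rule ccontr)
    assume "\<not> m < y"
    then have "y < m" using m_notin y by (metis linorder_neqE_nat)
    then have "bad4 m x0 T y" using x0 by (simp add: bad4_def)
    then show False using no4[OF m1[OF xT[OF x0(1) y]]] by blast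
  qed
  have YT: "y < T" if y: "y \<in> set Y" for y
  proof (rule ccontr)
    assume "\<not> y < T"
    then have "T < y" using T_notin y by (metis linorder_neqE_nat)
    then show False using no3[OF xT[OF x0(1) y]] x0 by blast
  qed
  have YX: "y < x" if x: "x \<in> set u" "m < x" "x < T" and y: "y \<in> set Y" for x y
  proof (rule ccontr)
    assume "\<not> y < x"
    moreover have "x \<noteq> y" using d R x y by auto
    ultimately have "bad4 m x T y" using x YT[OF y] by (simp add: bad4_def)
    then show False using no4[OF m1[OF xT[OF x(1) y]]] by blast
  qed
  have uT: "subseq [a, b, T] R" if "subseq [a, b] u" for a b
    using that by (simp add: R subseq3_append)
  have u_asc: "\<not> (a < b \<and> b < T)" if "subseq [a, b] u" for a b
    using no3[OF uT[OF that]] by blast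
  \<comment> \<open>An ascent \<open>a < b\<close> before \<open>T\<close> has \<open>a < m\<close>,
    since the entries above \<open>m\<close> decrease there, and \<open>T < b\<close>, since
    otherwise \<open>a b T\<close> is a 123. Then \<open>b\<close> precedes \<open>x0\<close>, hence
    so does \<open>a\<close>, and \<open>a x0 T\<close> is a 123.\<close>
  have "dec u"
  proof (rule decI, rule ccontr)
    fix a b assume ab: "subseq [a, b] u" "\<not> b < a"
    have in_u: "a \<in> set u" "b \<in> set u" using subseq2D[OF ab(1)] by simp_all
    have "a \<noteq> b" using subseq2_distinct[OF ab(1)] d R by auto
    then have lt: "a < b" using ab(2) by simp
    have "\<not> (m < a \<and> m < b)" using decD[OF du, of a b] ab lt by (auto simp: subseq2_filter)
    then have am: "a < m" using lt m_notin in_u by (metis linorder_neqE_nat less_trans)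
    have "b \<noteq> T" using T_notin in_u by blast
    then have bT: "T < b" using u_asc[OF ab(1)] lt by simp
    have "subseq [b, x0] u"
      using subseq2_total[OF in_u(2) x0(1)] decD[OF du, of x0 b] bT x0 by (auto simp: subseq2_filter)
    then have "subseq [a, x0] u" using subseq2_trans[OF ab(1)] d R by simp
    then show False using u_asc am x0 by (meson less_trans)
  qed
  define D X A where "D = filter (\<lambda>x. T < x) u" and "X = filter (\<lambda>x. m < x \<and> x < T) u"
    and "A = filter (\<lambda>x. x < m) u"
  have u_eq: "u = D @ X @ A"
    unfolding D_def X_def A_def by (rule dec_partition[OF \<open>dec u\<close> mT m_notin(1) T_notin(1)])
  have LT: "l < T" if l: "l \<in> set L" for l
  proof (rule ccontr)
    assume "\<not> l < T"
    then have Tl: "T < l" using T_notin l by (metis linorder_neqE_nat)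
    have "subseq [x0, T] R" using x0 by (simp add: R subseq2_append)
    then have "subseq [l, m, x0, T] (L @ R)"
      using lm[OF l] Tl mT by (auto simp: subseq4_append)
    moreover have "bad4 l m x0 T" using x0 Tl by (simp add: bad4_def)
    ultimately show False using no4 by blast
  qed
  have sY: "subseq [a, b, c] R" if "subseq [a, b, c] Y" for a b c
    using that by (simp add: R subseq3_append subseq3_Cons)
  have avY: "av123 Y" using no3 sY unfolding subseq_no3 by blast
  have avY': "av132 Y"
    unfolding subseq_no3
  proof (intro allI impI notI)
    fix a b c assume abc: "subseq [a, b, c] Y" "a < c \<and> c < b"
    then have "bad4 m a b c" using Ym[of a] subseq3_set[OF abc(1)] by (simp add: bad4_def)
    then show False using no4[OF m1[OF sY[OF abc(1)]]] by blast
  qed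
  have gap: "l < y \<or> x < l" if l: "l \<in> set L" and x: "x \<in> set X" and y: "y \<in> set Y" for l x y
  proof (rule ccontr)
    assume *: "\<not> (l < y \<or> x < l)"
    have "l \<noteq> y" "l \<noteq> x" using d R l x y by (auto simp: u_eq)
    then have "y < l" "l < x" using * by auto
    then have "bad4 l x T y" using x by (simp add: bad4_def X_def)
    moreover have "subseq [l, x, T, y] (L @ R)"
      using xT[of x y] x y l by (simp add: subseq4_append X_def)
    ultimately show False using no4 by blast
  qed
  have x0X: "x0 \<in> set X" using x0 by (simp add: X_def)
  have dY: "dec Y" if "A \<noteq> [] \<or> (\<exists>l\<in>set L. \<exists>y\<in>set Y. y < l)"
  proof (rule ccontr)
    assume "\<not> dec Y"
    then obtain y1 y2 where y: "subseq [y1, y2] Y" "y1 < y2" using not_dec_obtain[OF \<open>\<not> dec Y\<close>] d R by auto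
    have yY: "y1 \<in> set Y" "y2 \<in> set Y" using subseq2D[OF y(1)] by simp_all
    from that show False
    proof
      assume "A \<noteq> []"
      then obtain a where "a \<in> set A" by (cases A) auto
      then have a: "a \<in> set u" "a < m" by (simp_all add: A_def)
      then have "subseq [a, y1, y2] R" using y(1) by (simp add: R subseq3_append subseq2_Cons)
      then show False using no3 a Ym[OF yY(1)] y(2) by (meson less_trans)
    next
      assume "\<exists>l\<in>set L. \<exists>y\<in>set Y. y < l"
      \<comment> \<open>If \<open>l\<close> exceeds one value of \<open>Y\<close>, the gap condition
        lifts it above \<open>x0\<close> and so above all of \<open>Y\<close>.\<close>
      then obtain l y' where l: "l \<in> set L" "y' \<in> set Y" "y' < l" by blast
      then have "x0 < l" using gap[OF l(1) x0X l(2)] by simp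
      then have "y2 < l" using YX[OF x0 yY(2)] by simp
      moreover have "l \<noteq> m" using l Ym[of y'] by auto
      then have "subseq [l, m, y1, y2] (L @ R)"
        using lm[OF l(1)] y(1) by (simp add: R subseq4_append subseq2_append subseq2_Cons)
      ultimately show False using no4 Ym[OF yY(1)] y(2) unfolding bad4_def by blast
    qed
  qed
  have am: "a < z" if "a \<in> set A" "z \<in> set L \<union> set X \<union> set Y" for a z
    using that m_le[of z] Ym[of z] by (auto simp: A_def X_def)
  have zT: "z < T" if "z \<in> set L \<union> set X \<union> set Y" for z
    using that LT YT by (auto simp: X_def)
  have DT: "T < e" if "e \<in> set D" for e using that by (simp add: D_def)
  have XY: "y < x" if "x \<in> set X" "y \<in> set Y" for x y using that YX by (simp add: X_def)
  have mz: "last L < z" if "z \<in> set X \<union> set Y" for z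
    using that Ym by (auto simp: X_def m_def)
  have "dec (D @ X @ A)" using \<open>dec u\<close> u_eq by metis
  then have "hooked L D X A T Y"
    unfolding hooked_def
  proof (intro conjI)
    show "L \<noteq> []" "dec L" "av123 Y" "av132 Y" by fact+
    show "X \<noteq> []" using x0X by auto
    show "Y \<noteq> [] \<longrightarrow> (\<forall>l\<in>set L. (\<forall>y\<in>set Y. l < y) \<or> (\<forall>x\<in>set X. x < l))" using gap by blast
  qed (use am zT DT XY mz dY in blast)+
  moreover have "R = D @ X @ A @ T # Y" using R u_eq by simp
  ultimately show thesis using that by blast
qed

text \<open>Here a word is indexed by values, starting at \<open>i\<close>, and not by positions as
  in \<open>merge_runs\<close>: \<open>L\<close> and \<open>X\<close> are decreasing and separated
  in position, so only the interleaving of their values is free.\<close>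

fun pick :: "bool \<Rightarrow> nat \<Rightarrow> bool list \<Rightarrow> nat list" where
  "pick b i [] = []"
| "pick b i (c # w) = (if c = b then i # pick b (Suc i) w else pick b (Suc i) w)"

lemma pick_bounds: "x \<in> set (pick b i w) \<Longrightarrow> i \<le> x \<and> x < i + length w"
  by (induction w arbitrary: i) (fastforce split: if_splits)+

lemma dec_rev_pick [simp]: "dec (rev (pick b i w))"
  unfolding sorted_wrt_rev by (induction w arbitrary: i) (auto dest: pick_bounds)

lemma set_pick_Un: "set (pick True i w) \<union> set (pick False i w) = {i..<i + length w}"
proof (induction w arbitrary: i)
  case (Cons c w)
  have "{i..<i + length (c # w)} = insert i {Suc i..<Suc i + length w}" by auto
  then show ?case using Cons[of "Suc i"] by (cases c) auto
qed simp

lemma set_pick_Int: "set (pick True i w) \<inter> set (pick False i w) = {}"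
  by (induction w arbitrary: i) (auto dest: pick_bounds)

lemma length_pick: "length (pick True i w) + length (pick False i w) = length w"
  by (induction w arbitrary: i) auto

lemma pick_eq_Nil: "pick b i w = [] \<longleftrightarrow> b \<notin> set w"
  by (induction w arbitrary: i) auto

lemma pick_sorted: "sorted w \<Longrightarrow> x \<in> set (pick False i w) \<Longrightarrow> y \<in> set (pick True i w) \<Longrightarrow> x < y"
proof (induction w arbitrary: i)
  case (Cons c w)
  show ?case
  proof (cases c)
    case True
    then have "False \<notin> set (c # w)" using Cons.prems(1) by auto
    then show ?thesis using Cons.prems(2) pick_eq_Nil by (metis list.set(1) empty_iff)
  next
    case False
    then show ?thesis using Cons by (auto dest: pick_bounds)
  qed
qed simp

lemma pick_inj: "length w = length w' \<Longrightarrow> pick True i w = pick True i w' \<Longrightarrow> w = w'"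
proof (induction w w' arbitrary: i rule: list_induct2)
  case (Cons c w c' w')
  have "i \<notin> set (pick True (Suc i) v)" for v using pick_bounds[of i True "Suc i" v] by auto
  then have "c = c'" using Cons.prems by (auto split: if_splits) (metis list.set_intros(1))+
  then show ?case using Cons by (auto split: if_splits)
qed simp

lemma pick_map: "pick b i (map f [i..<j]) = filter (\<lambda>v. f v = b) [i..<j]"
proof (cases "i \<le> j")
  case True
  then show ?thesis
  proof (induction i rule: inc_induct)
    case (step i)
    then show ?case by (simp add: upt_conv_Cons)
  qed simp
qed simp

text \<open>In the order of their values, the entries are: \<open>a\<close> entries of \<open>A\<close>, the \<open>s + 1\<close> last entries of \<open>L\<close>,
  the entries of \<open>Y\<close>, the word \<open>w\<close> with \<open>True\<close> for \<open>L\<close> and \<open>False\<close> for \<open>X\<close>, then \<open>T\<close>,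
  \<open>d\<close> entries of \<open>D\<close>, and the maximum. If \<open>Y\<close> is empty, then \<open>s = 0\<close> makes the data unique,
  since the other entries of \<open>L\<close> can be recorded in \<open>w\<close>.\<close>

type_synonym hook_data = "nat \<times> nat \<times> nat list \<times> bool list \<times> nat"

definition hook_params :: "hook_data set" where
  "hook_params = {(a, s, Y, w, d). Y \<in> layered \<and> False \<in> set w \<and>
     (if Y = [] then s = 0 else sorted w \<and> (a > 0 \<or> True \<in> set w \<longrightarrow> dec Y))}"

text \<open>The number \<open>a + s + 2 + length Y\<close> is the first value of the block described
  by \<open>w\<close>.\<close>

definition hook_left :: "hook_data \<Rightarrow> nat list" where
  "hook_left = (\<lambda>(a, s, Y, w, d). rev (pick True (a + s + 2 + length Y) w) @ rev [a + 1..<a + s + 2])"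

definition hook_right :: "hook_data \<Rightarrow> nat list" where
  "hook_right = (\<lambda>(a, s, Y, w, d). let i = a + s + 2 + length Y; t = i + length w in
     rev [t + 1..<t + 1 + d] @ rev (pick False i w) @ rev [1..<a + 1] @ t # map ((+) (a + s + 1)) Y)"

definition hook_perm :: "hook_data \<Rightarrow> nat list" where
  "hook_perm u = hook_left u @ Suc (length (hook_left u @ hook_right u)) # hook_right u"

text \<open>Most conditions of \<open>hooked\<close> become bounds between intervals of values. Only
  \<open>L\<close> and \<open>X\<close> interleave; for nonempty \<open>Y\<close>, sortedness of
  \<open>w\<close> puts \<open>X\<close> below the entries of \<open>L\<close> above
  \<open>Y\<close>, which is the gap condition.\<close>

lemma hook_split:
  assumes "(a, s, Y, w, d) \<in> hook_params"
  defines "i \<equiv> a + s + 2 + length Y"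
  defines "t \<equiv> i + length w"
  shows "hooked (hook_left (a, s, Y, w, d)) (rev [t + 1..<t + 1 + d]) (rev (pick False i w)) (rev [1..<a + 1]) t
      (map ((+) (a + s + 1)) Y)" (is "hooked ?L ?D ?X ?A t ?Y")
    and "hook_left (a, s, Y, w, d) @ hook_right (a, s, Y, w, d) \<in> perms"
proof -
  have Y: "distinct Y" "set Y = {1..length Y}" "av123 Y" "av132 Y" and w: "False \<in> set w"
    and Yw: "Y = [] \<Longrightarrow> s = 0" "Y \<noteq> [] \<Longrightarrow> sorted w"
    using assms(1) by (simp_all add: hook_params_def layered_def perms_def split: if_splits)
  have dY: "dec Y" if "Y \<noteq> []" "a > 0 \<or> True \<in> set w"
    using that assms(1) unfolding hook_params_def by auto
  have L: "?L = rev (pick True i w) @ rev [a + 1..<a + s + 2]"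
    by (simp add: hook_left_def i_def del: upt_Suc)
  have setY: "set ?Y = {a + s + 2..<i}"
  proof -
    have "set ?Y = (+) (a + s + 1) ` {1..length Y}" using Y(2) by simp
    also have "\<dots> = {a + s + 2..<i}" unfolding image_add_atLeastAtMost by (auto simp: i_def)
    finally show ?thesis .
  qed
  have setL: "set ?L = set (pick True i w) \<union> {a + 1..<a + s + 2}" by (simp add: L del: upt_Suc)
  have pb: "i \<le> x \<and> x < t" if "x \<in> set (pick b i w)" for x b
    using pick_bounds[OF that] by (simp add: t_def)
  have lastL: "last ?L = a + 1" by (simp add: L last_rev hd_upt del: upt_Suc)
  have bL: "a < x \<and> x < t" if "x \<in> set ?L" for x
    using that pb[of x True] unfolding setL by (auto simp: i_def t_def)
  have bX: "i \<le> x \<and> x < t" if "x \<in> set ?X" for x using that pb by simp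
  have bY: "a + s + 2 \<le> y \<and> y < i" if "y \<in> set ?Y" for y using that unfolding setY by simp
  show "hooked ?L ?D ?X ?A t ?Y"
    unfolding hooked_def
  proof (intro conjI)
    show "?L \<noteq> []" by (simp add: L)
    show "?X \<noteq> []" using w by (simp add: pick_eq_Nil)
    show "dec ?L" unfolding L dec_append
      using pb by (fastforce simp: i_def simp del: upt_Suc)
    show "dec (?D @ ?X @ ?A)" unfolding dec_append
      using bX by (fastforce simp: i_def t_def simp del: upt_Suc)
    show "\<forall>b\<in>set ?A. \<forall>z\<in>set ?L \<union> set ?X \<union> set ?Y. b < z"
      using bL bX bY by (fastforce simp: i_def simp del: upt_Suc set_map)
    show "\<forall>z\<in>set ?L \<union> set ?X \<union> set ?Y. z < t"
      using bL bX bY by (fastforce simp: t_def simp del: upt_Suc set_map)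
    show "\<forall>d\<in>set ?D. t < d" by auto
    show "\<forall>x\<in>set ?X. \<forall>y\<in>set ?Y. y < x" using bX bY by (meson less_le_trans)
    show "\<forall>z\<in>set ?X \<union> set ?Y. last ?L < z"
      unfolding lastL using bX bY by (fastforce simp: i_def simp del: set_map)
    show "av123 ?Y" "av132 ?Y" using Y by (simp_all add: map_add_layered)
    show "?Y \<noteq> [] \<longrightarrow> (\<forall>l\<in>set ?L. (\<forall>y\<in>set ?Y. l < y) \<or> (\<forall>x\<in>set ?X. x < l))"
    proof (intro impI ballI)
      fix l assume "?Y \<noteq> []" "l \<in> set ?L"
      then have "sorted w" using Yw by simp
      from \<open>l \<in> set ?L\<close> consider "l \<in> set (pick True i w)" | "l < a + s + 2" unfolding setL by auto
      then show "(\<forall>y\<in>set ?Y. l < y) \<or> (\<forall>x\<in>set ?X. x < l)"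
      proof cases
        case 1
        then show ?thesis using pick_sorted[OF \<open>sorted w\<close>] by auto
      next
        case 2
        then show ?thesis using bY by fastforce
      qed
    qed
    show "?A \<noteq> [] \<or> (\<exists>l\<in>set ?L. \<exists>y\<in>set ?Y. y < l) \<longrightarrow> dec ?Y"
    proof
      assume *: "?A \<noteq> [] \<or> (\<exists>l\<in>set ?L. \<exists>y\<in>set ?Y. y < l)"
      show "dec ?Y"
      proof (cases "Y = []")
        case False
        have "True \<in> set w" if "l \<in> set ?L" "y \<in> set ?Y" "y < l" for l y
          using that bY[of y] pick_eq_Nil[of True i w] unfolding setL by (cases "pick True i w") auto
        then have "a > 0 \<or> True \<in> set w" using * by (cases "a = 0") auto
        then show ?thesis using dY[OF False] by simp
      qed simp
    qed
  qed
  have R: "hook_right (a, s, Y, w, d) = ?D @ ?X @ ?A @ t # ?Y"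
    unfolding hook_right_def prod.case Let_def i_def t_def by (rule refl)
  have "distinct (?L @ ?D @ ?X @ ?A @ t # ?Y)"
  proof -
    have "distinct ?L" "distinct ?X" "distinct ?A" "distinct ?D" "distinct ?Y"
    proof -
      have "dec ?L" using \<open>hooked ?L ?D ?X ?A t ?Y\<close> unfolding hooked_def by - (elim conjE, assumption)
      then show "distinct ?L" by (rule dec_distinct)
      show "distinct ?X" by (rule dec_distinct) simp
      show "distinct ?A" "distinct ?D" by (simp_all del: upt_Suc)
      show "distinct ?Y" using Y(1) by (simp add: distinct_map)
    qed
    moreover have "set ?L \<inter> set ?X = {}"
      using set_pick_Int[of i w] bX unfolding setL by (fastforce simp: i_def)
    moreover have "set ?L \<inter> set ?Y = {}"
      using pb[of _ True] unfolding setL setY by fastforce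
    moreover have "set ?X \<inter> set ?Y = {}" using bX bY by (metis disjoint_iff not_less)
    moreover have "set ?L \<inter> set ?A = {}" "set ?L \<inter> set ?D = {}" "t \<notin> set ?L" using bL by fastforce+
    moreover have "set ?X \<inter> set ?A = {}" "set ?X \<inter> set ?D = {}" "t \<notin> set ?X"
      using bX by (fastforce simp: i_def)+
    moreover have "set ?Y \<inter> set ?A = {}" "set ?Y \<inter> set ?D = {}" "t \<notin> set ?Y"
      unfolding setY by (auto simp: i_def t_def)
    moreover have "set ?A \<inter> set ?D = {}" "t \<notin> set ?A" "t \<notin> set ?D" by (auto simp: i_def t_def)
    ultimately show ?thesis by (auto simp del: upt_Suc set_map set_rev)
  qed
  moreover have "set (?L @ ?D @ ?X @ ?A @ t # ?Y) = {1..length (?L @ ?D @ ?X @ ?A @ t # ?Y)}"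
  proof -
    have len: "length (?L @ ?D @ ?X @ ?A @ t # ?Y) = t + d"
      using length_pick[of i w] by (simp add: L t_def i_def del: upt_Suc)
    have "set (?L @ ?D @ ?X @ ?A @ t # ?Y) =
       (set (pick True i w) \<union> set (pick False i w)) \<union> {a + 1..<a + s + 2} \<union> set ?D \<union> set ?A \<union> {t} \<union> set ?Y"
      unfolding set_append setL list.set by auto
    also have "\<dots> = {1..t + d}"
      unfolding set_pick_Un setY set_rev set_upt by (auto simp: i_def t_def)
    finally show ?thesis unfolding len .
  qed
  ultimately show "?L @ hook_right (a, s, Y, w, d) \<in> perms" unfolding R perms_def by simp
qed

lemma hook_perms_subset:
  assumes "u \<in> hook_params"
  defines "L \<equiv> hook_left u" and "R \<equiv> hook_right u"
  shows "L @ R \<in> perms" "good (L @ Suc (length (L @ R)) # R)" "R \<noteq> []" "dec L"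
    "\<not> av123 (L @ Suc (length (L @ R)) # R)"
proof -
  obtain a s Y w d where u: "u = (a, s, Y, w, d)" by (cases u)
  note h = hook_split[OF assms(1)[unfolded u], folded u L_def R_def]
  show p: "L @ R \<in> perms" by (fact h)
  define t where "t = a + s + 2 + length Y + length w"
  have R: "R = rev [t + 1..<t + 1 + d] @ rev (pick False (a + s + 2 + length Y) w) @ rev [1..<a + 1] @ t #
      map ((+) (a + s + 1)) Y"
    unfolding R_def u hook_right_def prod.case Let_def t_def by (rule refl)
  have dist: "distinct (L @ R)" using p by (simp add: perms_def)
  show "good (L @ Suc (length (L @ R)) # R)" "\<not> av123 (L @ Suc (length (L @ R)) # R)"
    using hooked_good[OF h(1)[folded t_def], folded R, OF dist perms_lessD[OF p]] by simp_all
  show "R \<noteq> []" by (simp add: R)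
  show "dec L" using h(1) unfolding hooked_def by blast
qed

text \<open>By value the blocks are ordered \<open>A\<close>, \<open>L0\<close>, \<open>Y\<close>,
  \<open>L1\<close> together with \<open>X\<close>, \<open>T\<close>, \<open>D\<close>. Peeling them
  off from below with \<open>upt_split\<close> fixes all values except the interleaving of
  \<open>L1\<close> and \<open>X\<close>, which becomes \<open>w\<close>.\<close>

lemma hook_perms_supset:
  assumes p: "L @ R \<in> perms" and g: "good (L @ Suc (length (L @ R)) # R)" "dec L"
    and n123: "\<not> av123 (L @ Suc (length (L @ R)) # R)"
  shows "\<exists>u\<in>hook_params. L = hook_left u \<and> R = hook_right u"
proof -
  let ?N = "Suc (length (L @ R))"
  have dist: "distinct (L @ R)" using p by (simp add: perms_def)
  obtain D X A T Y where R: "R = D @ X @ A @ T # Y" and h: "hooked L D X A T Y"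
    using hookedI[OF g(1) dist perms_lessD[OF p] g(2) n123] by blast
  have ne: "L \<noteq> []" "X \<noteq> []" and dU: "dec (D @ X @ A)" and av: "av123 Y" "av132 Y"
    and A: "\<forall>a\<in>set A. \<forall>z\<in>set L \<union> set X \<union> set Y. a < z"
    and T: "\<forall>z\<in>set L \<union> set X \<union> set Y. z < T" and D: "\<forall>d\<in>set D. T < d"
    and XY: "\<forall>x\<in>set X. \<forall>y\<in>set Y. y < x" and last: "\<forall>z\<in>set X \<union> set Y. last L < z"
    and gap: "Y \<noteq> [] \<longrightarrow> (\<forall>l\<in>set L. (\<forall>y\<in>set Y. l < y) \<or> (\<forall>x\<in>set X. x < l))"
    and dY: "A \<noteq> [] \<or> (\<exists>l\<in>set L. \<exists>y\<in>set Y. y < l) \<longrightarrow> dec Y"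
    using h unfolding hooked_def by - (elim conjE, assumption)+
  have dd: "dec D" "dec X" "dec A" using dU by (simp_all add: dec_append)
  \<comment> \<open>The entry \<open>last L\<close> is included explicitly, so that
    \<open>L0\<close> is a singleton if \<open>Y\<close> is empty, in accordance with
    \<open>s = 0\<close>.\<close>
  define P where "P l \<longleftrightarrow> l = last L \<or> (\<exists>y\<in>set Y. l < y)" for l
  define L0 L1 where "L0 = filter P L" and "L1 = filter (\<lambda>l. \<not> P l) L"
  have gap': "x < l" if "l \<in> set L" "y \<in> set Y" "\<not> l < y" "x \<in> set X" for l x y
    using gap that by (metis empty_iff list.set(1))
  obtain x0 where x0: "x0 \<in> set X" using ne by (cases X) auto
  have L0Y: "l < y" if l: "l \<in> set L0" and y: "y \<in> set Y" for l y
  proof (rule ccontr)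
    assume "\<not> l < y"
    then have "x0 < l" using gap' l y x0 by (simp add: L0_def)
    moreover have "last L < x0" "\<forall>y\<in>set Y. y < x0" using last XY x0 by blast+
    ultimately have "\<not> P l" unfolding P_def by (meson less_asym less_trans)
    then show False using l by (simp add: L0_def)
  qed
  have L0X: "l < x" if "l \<in> set L0" "x \<in> set X" for l x
    using that last XY by (auto simp: L0_def P_def) (meson less_trans)
  have L01: "l < l'" if "l \<in> set L0" "l' \<in> set L1" for l l'
  proof -
    have l': "l' \<in> set L" "l' \<noteq> last L" "\<forall>y\<in>set Y. \<not> l' < y" using that(2) by (auto simp: L1_def P_def)
    then have "last L < l'" using dec_last_le[OF g(2)] by (metis le_neq_implies_less)
    moreover have "l < l'" if "y \<in> set Y" "l < y" for y using l'(3) that by (meson less_le_trans not_less)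
    ultimately show ?thesis using that(1) by (auto simp: L0_def P_def)
  qed
  have YL1: "y < l" if "y \<in> set Y" "l \<in> set L1" for y l
  proof -
    have "l \<noteq> y" using dist that R by (auto simp: L1_def)
    then show ?thesis using that by (auto simp: L1_def P_def not_less le_less)
  qed
  have dL: "dec L0" "dec L1" unfolding L0_def L1_def using g(2) by (simp_all add: sorted_wrt_filter)
  have L: "L = L1 @ L0"
  proof (rule dec_eqI[OF g(2)])
    show "dec (L1 @ L0)" using dL L01 by (simp add: dec_append)
  qed (auto simp: L0_def L1_def)
  have distL: "distinct L0" "distinct L1" "distinct X" "distinct A" "distinct D" "distinct Y"
    using dist unfolding R by (simp_all add: L0_def L1_def)
  have setp: "set (A @ L0 @ Y @ L1 @ X @ T # D) = {1..<?N}"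
  proof -
    have "set (A @ L0 @ Y @ L1 @ X @ T # D) = set (L @ R)" unfolding L R by auto
    also have "\<dots> = {1..<?N}" using p by (simp add: perms_def atLeastLessThanSuc_atLeastAtMost)
    finally show ?thesis .
  qed
  have distp: "distinct (A @ L0 @ Y @ L1 @ X @ T # D)"
    using dist unfolding R L distinct_append set_append distinct.simps list.set by blast
  have mem: "set L0 \<subseteq> set L" "set L1 \<subseteq> set L" by (auto simp: L0_def L1_def)
  have zT: "\<forall>z\<in>set L0 \<union> set L1 \<union> set X \<union> set Y. z < T" using T mem by blast
  have zD: "\<forall>z\<in>set L0 \<union> set L1 \<union> set X \<union> set Y. \<forall>e\<in>set D. z < e" using zT D by (meson less_trans)
  have Az: "\<forall>a\<in>set A. \<forall>z\<in>set L0 \<union> set L1 \<union> set X \<union> set Y. a < z" using A mem by blast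
  have AT: "\<forall>a\<in>set A. a < T" using Az zT x0 by (meson UnI1 UnI2 less_trans)
  have AD: "\<forall>a\<in>set A. \<forall>e\<in>set D. a < e" using AT D by (meson less_trans)
  have "x < y" if "x \<in> set A" "y \<in> set (L0 @ Y @ L1 @ X @ T # D)" for x y
    using that Az AT AD by auto
  note 1 = upt_split[where xs = "A" and ys = "L0 @ Y @ L1 @ X @ T # D" and i = 1 and k = "?N", OF _ _ _ this]
  have 1: "set A = {1..<1 + length A}" "set (L0 @ Y @ L1 @ X @ T # D) = {1 + length A..<?N}"
    by (rule 1; use setp distp in simp)+
  have "x < y" if "x \<in> set L0" "y \<in> set (Y @ L1 @ X @ T # D)" for x y
    using that L0Y L01 L0X zT zD by auto
  note 2 = upt_split[where xs = "L0" and ys = "Y @ L1 @ X @ T # D" and i = "1 + length A" and k = "?N", OF _ _ _ this]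
  have 2: "set L0 = {1 + length A..<1 + length A + length L0}"
    "set (Y @ L1 @ X @ T # D) = {1 + length A + length L0..<?N}"
    by (rule 2; use 1(2) distp in simp)+
  let ?i = "1 + length A + length L0 + length Y"
  have "x < y" if "x \<in> set Y" "y \<in> set (L1 @ X @ T # D)" for x y
    using that YL1 XY zT zD by auto
  note 3 = upt_split[where xs = "Y" and ys = "L1 @ X @ T # D" and i = "1 + length A + length L0" and k = "?N", OF _ _ _ this]
  have 3: "set Y = {1 + length A + length L0..<?i}" "set (L1 @ X @ T # D) = {?i..<?N}"
    by (rule 3; use 2(2) distp in simp)+
  let ?t = "?i + length (L1 @ X)"
  have "x < y" if "x \<in> set (L1 @ X)" "y \<in> set (T # D)" for x y
    using that zT zD by auto
  note 4 = upt_split[where xs = "L1 @ X" and ys = "T # D" and i = "?i" and k = "?N", OF _ _ _ this]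
  have 4: "set (L1 @ X) = {?i..<?t}" "set (T # D) = {?t..<?N}"
  proof -
    have s: "set (L1 @ X) \<union> set (T # D) = {?i..<?N}" using 3(2) by (simp add: Un_assoc)
    have d: "distinct (L1 @ X)" "distinct (T # D)" using distp by auto
    show "set (L1 @ X) = {?i..<?t}" "set (T # D) = {?t..<?N}"
      using 4(1)[OF s d] 4(2)[OF s d] by simp_all
  qed
  have "x < y" if "x \<in> set [T]" "y \<in> set D" for x y
    using that D by auto
  note 5 = upt_split[where xs = "[T]" and ys = "D" and i = "?t" and k = "?N", OF _ _ _ this]
  have "set [T] = {?t..<?t + length [T]}" "set D = {?t + length [T]..<?N}"
    by (rule 5; use 4(2) distp in simp)+
  then have 5: "T = ?t" "set D = {?t + 1..<?N}" by auto
  obtain Y' where Y': "Y' \<in> perms" "Y = map ((+) (length A + length L0)) Y'"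
    using perms_shift[OF 3(1)] distL by auto
  have lenY: "length Y' = length Y" using arg_cong[OF Y'(2), of length] by simp
  define w where "w = map (\<lambda>v. v \<in> set L1) [?i..<?t]"
  have lw: "length w = length (L1 @ X)" by (simp add: w_def del: upt_Suc)
  have L1X: "set L1 \<inter> set X = {}" using distp by auto
  have setpick: "set (pick True ?i w) = set L1" "set (pick False ?i w) = set X"
  proof -
    show "set (pick True ?i w) = set L1"
      unfolding w_def pick_map using 4(1) by (simp only: set_filter set_upt eq_True) auto
    show "set (pick False ?i w) = set X"
      unfolding w_def pick_map using 4(1) L1X by (simp only: set_filter set_upt eq_False) auto
  qed
  have L1_eq: "L1 = rev (pick True ?i w)" and X_eq: "X = rev (pick False ?i w)"
    by (rule dec_eqI; use dL dd setpick in simp)+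
  have "last L \<in> set L0" using ne by (simp add: L0_def P_def)
  then have L0_pos: "length L0 > 0" by (cases L0) auto
  define s where "s = length L0 - 1"
  have s: "length L0 = s + 1" using L0_pos by (simp add: s_def)
  let ?u = "(length A, s, Y', w, length D)"
  have i: "length A + s + 2 + length Y' = ?i" by (simp add: s lenY)
  have "L0 = rev [1 + length A..<1 + length A + length L0]" by (rule dec_eq_rev_upt[OF dL(1) 2(1)])
  then have "L0 = rev [length A + 1..<length A + s + 2]" by (simp add: s del: upt_Suc)
  then have "L = hook_left ?u"
    unfolding L hook_left_def prod.case i using L1_eq by simp
  moreover have "R = hook_right ?u"
  proof -
    have "A = rev [1..<1 + length A]" by (rule dec_eq_rev_upt[OF dd(3) 1(1)])
    moreover have "?N = ?t + 1 + length D" by (simp add: L R)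
    then have "D = rev [?t + 1..<?t + 1 + length D]" using dec_eq_rev_upt[OF dd(1) 5(2)] by simp
    moreover have "Y = map ((+) (length A + s + 1)) Y'" using Y'(2) s by simp
    ultimately show ?thesis
      unfolding R hook_right_def prod.case Let_def i lw using X_eq 5(1) by (metis add.commute)
  qed
  moreover have "?u \<in> hook_params"
  proof -
    have "av123 Y'" "av132 Y'" "dec Y \<longleftrightarrow> dec Y'" "Y = [] \<longleftrightarrow> Y' = []"
      using av unfolding Y'(2) map_add_layered by simp_all
    moreover have "False \<in> set w" using pick_eq_Nil[of False ?i w] X_eq ne by auto
    moreover have "s = 0" if "Y = []"
    proof -
      have "set L0 \<subseteq> {last L}" using that by (auto simp: L0_def P_def)
      then have "card (set L0) \<le> 1" using card_mono[of "{last L}"] by fastforce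
      then show ?thesis using distinct_card[OF distL(1)] s by simp
    qed
    \<comment> \<open>An entry of \<open>L1\<close> lies above \<open>Y\<close>, so the gap
      condition puts all of \<open>X\<close> below it: after a \<open>True\<close> no
      \<open>False\<close> follows.\<close>
    moreover have "sorted w" if "Y \<noteq> []"
    proof -
      have "v' \<in> set L1" if v: "v \<in> set L1" "v < v'" "v' \<in> {?i..<?t}" for v v'
      proof (rule ccontr)
        assume "v' \<notin> set L1"
        moreover have "v' \<in> set (L1 @ X)" unfolding 4(1) by (rule v(3))
        ultimately have "v' \<in> set X" by simp
        moreover obtain y where "y \<in> set Y" using \<open>Y \<noteq> []\<close> by (cases Y) auto
        then have "\<not> v < y" using YL1[OF _ v(1)] less_asym by blast
        then have "\<forall>x\<in>set X. x < v" using gap'[OF _ \<open>y \<in> set Y\<close>] v(1) mem by blast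
        ultimately show False using v(2) by (meson less_asym)
      qed
      then have "sorted_wrt (\<lambda>v v'. (v \<in> set L1) \<le> (v' \<in> set L1)) [?i..<?t]"
        by (intro sorted_wrt_mono_rel[OF _ sorted_wrt_upt]) auto
      then show ?thesis unfolding w_def sorted_wrt_map .
    qed
    moreover have "dec Y" if Yw: "Y \<noteq> []" "length A > 0 \<or> True \<in> set w"
    proof (cases "A = []")
      case True
      then have "L1 \<noteq> []" using Yw(2) pick_eq_Nil[of True ?i w] L1_eq by auto
      then obtain l y where "l \<in> set L1" "y \<in> set Y" using Yw(1) list.set_sel(1) by blast
      then show ?thesis using dY YL1[of y l] mem by blast
    qed (use dY in simp)
    ultimately show ?thesis using Y'(1) by (auto simp: hook_params_def layered_def)
  qed
  ultimately show ?thesis by blast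
qed

lemma hook_perms_eq:
  "max_split_perms (\<lambda>L R. good (L @ Suc (length (L @ R)) # R) \<and> R \<noteq> [] \<and> dec L \<and>
     \<not> av123 (L @ Suc (length (L @ R)) # R)) = hook_perm ` hook_params"
proof (intro equalityI subsetI)
  fix p assume "p \<in> hook_perm ` hook_params"
  then obtain u where "u \<in> hook_params" "p = hook_perm u" by blast
  then show "p \<in> max_split_perms (\<lambda>L R. good (L @ Suc (length (L @ R)) # R) \<and> R \<noteq> [] \<and> dec L \<and>
     \<not> av123 (L @ Suc (length (L @ R)) # R))"
    using hook_perms_subset[of u] unfolding max_split_perms_def hook_perm_def by blast
next
  fix p assume "p \<in> max_split_perms (\<lambda>L R. good (L @ Suc (length (L @ R)) # R) \<and> R \<noteq> [] \<and> dec L \<and>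
     \<not> av123 (L @ Suc (length (L @ R)) # R))"
  then obtain L R where "p = L @ Suc (length (L @ R)) # R" "\<exists>u\<in>hook_params. L = hook_left u \<and> R = hook_right u"
    using hook_perms_supset unfolding max_split_perms_def by blast
  then show "p \<in> hook_perm ` hook_params" unfolding hook_perm_def by blast
qed

text \<open>\<open>T\<close> is the first entry at which \<open>R\<close> stops decreasing, because
  the nonempty \<open>X\<close> before it lies below \<open>T\<close>. Comparison with
  \<open>T\<close> and \<open>last L\<close> then separates \<open>D\<close>, \<open>X\<close> and
  \<open>A\<close>.\<close>

lemma hooked_unique:
  assumes h: "hooked L D X A T Y" and h': "hooked L D' X' A' T' Y'"
    and eq: "D @ X @ A @ T # Y = D' @ X' @ A' @ T' # Y'"
  shows "D = D' \<and> X = X' \<and> A = A' \<and> T = T' \<and> Y = Y'"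
proof -
  have asc: "\<not> dec ((D @ X @ A) @ [T])" if "hooked L D X A T Y" for D X A T Y
  proof -
    have "X \<noteq> []" "\<forall>z\<in>set L \<union> set X \<union> set Y. z < T"
      using that unfolding hooked_def by - (elim conjE, assumption)+
    then obtain x where "x \<in> set X" "x < T" by (cases X) auto
    then have "x \<in> set (D @ X @ A)" "\<not> T < x" by auto
    then show ?thesis unfolding dec_append[of "D @ X @ A"] by (metis list.set_intros(1))
  qed
  have dec: "dec (D @ X @ A)" if "hooked L D X A T Y" for D X A T Y
    using that unfolding hooked_def by - (elim conjE, assumption)
  have no_ext: False if "hooked L D X A T Y" "hooked L D' X' A' T' Y'" "D @ X @ A = (D' @ X' @ A') @ T' # us"
    for D X A T Y D' X' A' T' Y' us
    using dec[OF that(1)] asc[OF that(2)] unfolding that(3) by (auto simp: dec_append)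
  have "(D @ X @ A) @ T # Y = (D' @ X' @ A') @ T' # Y'" using eq by simp
  then have "\<exists>us. D @ X @ A = (D' @ X' @ A') @ us \<and> us @ T # Y = T' # Y' \<or>
      (D @ X @ A) @ us = D' @ X' @ A' \<and> T # Y = us @ T' # Y'"
    by (rule append_eq_append_conv2[THEN iffD1])
  then obtain us where "D @ X @ A = (D' @ X' @ A') @ us \<and> us @ T # Y = T' # Y' \<or>
      (D @ X @ A) @ us = D' @ X' @ A' \<and> T # Y = us @ T' # Y'" ..
  note us = this
  \<comment> \<open>If one top came earlier than the other, the decreasing prefix before the later
    one would contain the ascent to the earlier one.\<close>
  have "us = []"
  proof (cases us)
    case (Cons v vs)
    then consider "D @ X @ A = (D' @ X' @ A') @ T' # vs" | "D' @ X' @ A' = (D @ X @ A) @ T # vs"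
      using us by auto
    then show ?thesis by cases (use no_ext[OF h h'] no_ext[OF h' h] in blast)+
  qed
  then have U: "D @ X @ A = D' @ X' @ A'" "T = T'" "Y = Y'" using us by auto
  have parts: "filter (\<lambda>x. T < x) (D @ X @ A) = D \<and> filter (\<lambda>x. x < T \<and> last L < x) (D @ X @ A) = X"
    if h: "hooked L D X A T Y" for D X A T Y
  proof -
    have *: "L \<noteq> []" "\<forall>a\<in>set A. \<forall>z\<in>set L \<union> set X \<union> set Y. a < z" "\<forall>z\<in>set L \<union> set X \<union> set Y. z < T"
      "\<forall>d\<in>set D. T < d" "\<forall>z\<in>set X \<union> set Y. last L < z"
      using h unfolding hooked_def by - (elim conjE, assumption)+
    have l: "last L \<in> set L" using *(1) by simp
    have "last L < T" using *(3) l by blast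
    have a: "a < last L" "a < T" if "a \<in> set A" for a
      using *(2) l that \<open>last L < T\<close> by (blast intro: less_trans)+
    have x: "x < T" "last L < x" if "x \<in> set X" for x using *(3,5) that by blast+
    have "filter (\<lambda>x. T < x) D = D" "filter (\<lambda>x. T < x) X = []" "filter (\<lambda>x. T < x) A = []"
      using *(4) x(1) a(2) unfolding filter_id_conv filter_empty_conv by (meson less_asym)+
    moreover have "filter (\<lambda>x. x < T \<and> last L < x) D = []" "filter (\<lambda>x. x < T \<and> last L < x) X = X"
      "filter (\<lambda>x. x < T \<and> last L < x) A = []"
      using *(4) x a(1) unfolding filter_id_conv filter_empty_conv by (meson less_asym)+
    ultimately show ?thesis by simp
  qed
  have "D = D'" "X = X'" using parts[OF h] parts[OF h'] U by metis+
  then show ?thesis using U by simp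
qed

lemma inj_hook_perm: "inj_on hook_perm hook_params"
proof (rule inj_onI)
  fix u u' assume uu: "u \<in> hook_params" "u' \<in> hook_params" and eq: "hook_perm u = hook_perm u'"
  obtain a s Y w d where u: "u = (a, s, Y, w, d)" by (cases u)
  obtain a' s' Y' w' d' where u': "u' = (a', s', Y', w', d')" by (cases u')
  note p = hook_perms_subset(1)[OF uu(1)] and p' = hook_perms_subset(1)[OF uu(2)]
  have "length (hook_perm u) = length (hook_perm u')" using eq by simp
  then have N: "length (hook_left u @ hook_right u) = length (hook_left u' @ hook_right u')"
    by (simp add: hook_perm_def)
  let ?N = "Suc (length (hook_left u @ hook_right u))"
  have "?N \<notin> set (hook_left u @ hook_right u)" using perms_lessD[OF p] by blast
  moreover have "?N \<notin> set (hook_left u' @ hook_right u')" using perms_lessD[OF p'] unfolding N by blast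
  moreover have "hook_left u @ ?N # hook_right u = hook_left u' @ ?N # hook_right u'"
    using eq unfolding hook_perm_def N .
  ultimately have LR: "hook_left u = hook_left u'" "hook_right u = hook_right u'"
    by (auto simp: append_Cons_eq_iff)
  define i where "i = a + s + 2 + length Y"
  define i' where "i' = a' + s' + 2 + length Y'"
  note h = hook_split(1)[OF uu(1)[unfolded u], folded i_def u]
    and h' = hook_split(1)[OF uu(2)[unfolded u'], folded i'_def u', folded LR(1)]
  have R: "hook_right u = rev [i + length w + 1..<i + length w + 1 + d] @ rev (pick False i w) @ rev [1..<a + 1] @
      (i + length w) # map ((+) (a + s + 1)) Y"
    unfolding u hook_right_def prod.case Let_def i_def by (rule refl)
  have R': "hook_right u' = rev [i' + length w' + 1..<i' + length w' + 1 + d'] @ rev (pick False i' w') @ rev [1..<a' + 1] @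
      (i' + length w') # map ((+) (a' + s' + 1)) Y'"
    unfolding u' hook_right_def prod.case Let_def i'_def by (rule refl)
  have "rev [i + length w + 1..<i + length w + 1 + d] = rev [i' + length w' + 1..<i' + length w' + 1 + d'] \<and>
      rev (pick False i w) = rev (pick False i' w') \<and> rev [1..<a + 1] = rev [1..<a' + 1] \<and>
      i + length w = i' + length w' \<and> map ((+) (a + s + 1)) Y = map ((+) (a' + s' + 1)) Y'"
    by (rule hooked_unique[OF h h']) (use LR(2) R R' in metis)
  then have D: "rev [i + length w + 1..<i + length w + 1 + d] = rev [i' + length w' + 1..<i' + length w' + 1 + d']"
    and A: "rev [1..<a + 1] = rev [1..<a' + 1]"
    and t: "i + length w = i' + length w'" and Y: "map ((+) (a + s + 1)) Y = map ((+) (a' + s' + 1)) Y'"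
    by - (elim conjE, assumption)+
  have d: "d = d'" using arg_cong[OF D, of length] by (simp del: upt_Suc)
  have a: "a = a'" using arg_cong[OF A, of length] by (simp del: upt_Suc)
  have lY: "length Y = length Y'" using arg_cong[OF Y, of length] by simp
  \<comment> \<open>For nonempty \<open>Y\<close> the shift of its values reveals \<open>s\<close>;
    for empty \<open>Y\<close> nothing in \<open>R\<close> does, and the convention
    \<open>s = 0\<close> decides.\<close>
  have s: "s = s'"
  proof (cases "Y = []")
    case True
    then show ?thesis using lY uu by (simp add: u u' hook_params_def split: if_splits)
  next
    case False
    have "set Y = {1..length Y}" "set Y' = {1..length Y}"
      using uu lY by (simp_all add: u u' hook_params_def layered_def perms_def split: if_splits)
    then have "(+) (a + s + 1) ` {1..length Y} = (+) (a' + s' + 1) ` {1..length Y}"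
      using arg_cong[OF Y, of set] by simp
    then have "{1 + (a + s + 1)..length Y + (a + s + 1)} = {1 + (a' + s' + 1)..length Y + (a' + s' + 1)}"
      unfolding image_add_atLeastAtMost .
    then show ?thesis using a False by (auto simp: Icc_eq_Icc Suc_le_eq)
  qed
  have Y: "Y = Y'" using Y a s by (simp add: inj_map_eq_map)
  have i: "i = i'" by (simp add: i_def i'_def a s Y)
  have "hook_left u = rev (pick True i w) @ rev [a + 1..<a + s + 2]"
    "hook_left u' = rev (pick True i' w') @ rev [a' + 1..<a' + s' + 2]"
    by (simp_all add: u u' hook_left_def i_def i'_def del: upt_Suc)
  then have "pick True i w = pick True i w'" using LR(1) a s i by (simp del: upt_Suc)
  then have "w = w'" using t i by (intro pick_inj) simp_all
  then show "u = u'" using u u' a s Y d by simp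
qed

section \<open>Counting the hooked permutations\<close>

lemma has_gf_words_False:
  "has_gf {w. False \<in> set w} length (inverse (1 - 2 * fps_X) - inverse (1 - fps_X))"
  "has_gf {w. sorted w \<and> False \<in> set w} length (fps_X * (inverse (1 - fps_X) * inverse (1 - fps_X)))"
  "has_gf {w. sorted w \<and> False \<in> set w \<and> True \<notin> set w} length (fps_X * inverse (1 - fps_X))"
proof -
  have rep: "w = replicate (length w) b \<longleftrightarrow> (\<not> b) \<notin> set w" for w b
    by (induction w) auto
  have 1: "{w. False \<in> set w} = UNIV - range (\<lambda>k. replicate k True)"
  proof (intro equalityI subsetI)
    fix w assume "w \<in> UNIV - range (\<lambda>k. replicate k True)"
    then have "w \<noteq> replicate (length w) True" by blast
    then show "w \<in> {w. False \<in> set w}" using rep[of w True] by simp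
  qed auto
  have "has_gf (range (\<lambda>k. replicate k True)) length (fps_X ^ 0 * inverse (1 - fps_X))"
    by (rule has_gf_image[OF has_gf_nat]) (auto simp: inj_def)
  then show "has_gf {w. False \<in> set w} length (inverse (1 - 2 * fps_X) - inverse (1 - fps_X))"
    unfolding 1 by (intro has_gf_Diff[OF has_gf_words]) simp_all
  have 2: "{w. sorted w \<and> False \<in> set w} = (\<lambda>(a, b). replicate (Suc a) False @ replicate (b + 0) True) ` UNIV"
  proof (intro equalityI subsetI)
    fix w assume w: "w \<in> {w. sorted w \<and> False \<in> set w}"
    then have "w \<in> {w. sorted w}" by simp
    then obtain a b where ab: "w = replicate a False @ replicate b True" unfolding sorted_bools by auto
    then have "a \<noteq> 0" using w by auto
    then obtain a' where "a = Suc a'" by (cases a) auto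
    then have "w = (\<lambda>(a, b). replicate (Suc a) False @ replicate (b + 0) True) (a', b)" using ab by simp
    then show "w \<in> (\<lambda>(a, b). replicate (Suc a) False @ replicate (b + 0) True) ` UNIV" by (rule range_eqI)
  qed (auto simp: sorted_append sorted_replicate)
  show "has_gf {w. sorted w \<and> False \<in> set w} length (fps_X * (inverse (1 - fps_X) * inverse (1 - fps_X)))"
    using has_gf_Suc_runs[of False True 0] unfolding 2 by simp
  have 3: "{w. sorted w \<and> False \<in> set w \<and> True \<notin> set w} = range (\<lambda>k. replicate (Suc k) False)"
  proof (intro equalityI subsetI)
    fix w assume w: "w \<in> {w. sorted w \<and> False \<in> set w \<and> True \<notin> set w}"
    then have "w = replicate (length w) False" "length w \<noteq> 0" using rep[of w False] by auto
    then have "w = replicate (Suc (length w - 1)) False" by simp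
    then show "w \<in> range (\<lambda>k. replicate (Suc k) False)" by (rule range_eqI)
  qed (auto simp: sorted_replicate simp flip: replicate_Suc)
  have "has_gf (range (\<lambda>k. replicate (Suc k) False)) length (fps_X ^ 1 * inverse (1 - fps_X))"
    by (rule has_gf_image[OF has_gf_nat]) (auto simp: inj_def)
  then show "has_gf {w. sorted w \<and> False \<in> set w \<and> True \<notin> set w} length (fps_X * inverse (1 - fps_X))"
    unfolding 3 by simp
qed

text \<open>The summands belong to \<open>Y\<close> empty (any \<open>w\<close> containing
  \<open>False\<close>), \<open>Y\<close> decreasing and nonempty (\<open>w\<close> sorted), and
  \<open>Y\<close> not decreasing (\<open>a = 0\<close> and \<open>w\<close> without
  \<open>True\<close>). The factor \<open>fps_X ^ 3\<close> stands for \<open>last L\<close>,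
  \<open>T\<close> and the maximum, which are always present.\<close>

lemma has_gf_hook:
  fixes g h :: "real fps"
  defines "g \<equiv> inverse (1 - fps_X)" and "h \<equiv> inverse (1 - 2 * fps_X)"
  shows "has_gf (hook_perm ` hook_params) length
    (fps_X ^ 3 * (g * (h - g) * g + g * (g * (fps_X * g * (fps_X * (g * g) * g))) +
       g * (((1 - fps_X) * h - g) * (fps_X * g * g))))"
proof -
  note gf = has_gf_nat[folded g_def] has_gf_words_False[folded g_def h_def]
    has_gf_decreasing_nonempty[folded g_def] has_gf_layered_diff[folded g_def h_def]
  let ?sz = "\<lambda>(a, u). a + (case u of (s, u) \<Rightarrow> s + (case u of (Y, u) \<Rightarrow> length Y + (case u of (w, d) \<Rightarrow> length w + d)))"
  let ?S1 = "UNIV \<times> {0} \<times> {[]} \<times> {w. False \<in> set w} \<times> UNIV :: hook_data set"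
  let ?S2 = "UNIV \<times> UNIV \<times> (decreasing - {[]}) \<times> {w. sorted w \<and> False \<in> set w} \<times> UNIV :: hook_data set"
  let ?S3 = "{0} \<times> UNIV \<times> (layered - decreasing) \<times> {w. sorted w \<and> False \<in> set w \<and> True \<notin> set w} \<times> UNIV :: hook_data set"
  have "has_gf ?S1 ?sz (g * (fps_X ^ 0 * (fps_X ^ length ([] :: nat list) * ((h - g) * g))))"
    by (intro has_gf_times gf has_gf_singleton)
  moreover have "has_gf ?S2 ?sz (g * (g * (fps_X * g * (fps_X * (g * g) * g))))"
    by (intro has_gf_times gf)
  moreover have "has_gf ?S3 ?sz (fps_X ^ 0 * (g * (((1 - fps_X) * h - g) * (fps_X * g * g))))"
    by (intro has_gf_times gf has_gf_singleton)
  moreover have Nil: "[] \<in> decreasing" by (simp add: decreasing_def)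
  ultimately have "has_gf (?S1 \<union> ?S2 \<union> ?S3) ?sz (g * (h - g) * g + g * (g * (fps_X * g * (fps_X * (g * g) * g))) +
       g * (((1 - fps_X) * h - g) * (fps_X * g * g)))"
    by (intro has_gf_Un) (auto simp: mult.assoc)
  moreover have "?S1 \<union> ?S2 \<union> ?S3 = hook_params"
    using decreasing_subset_layered Nil
    by (auto simp: hook_params_def decreasing_def layered_def split: if_splits)
  ultimately have "has_gf hook_params ?sz (g * (h - g) * g + g * (g * (fps_X * g * (fps_X * (g * g) * g))) +
       g * (((1 - fps_X) * h - g) * (fps_X * g * g)))" by simp
  moreover have "length (hook_perm u) = ?sz u + 3" for u
  proof -
    obtain a s Y w d where u: "u = (a, s, Y, w, d)" by (cases u)
    show ?thesis
      using length_pick[of "a + s + 2 + length Y" w]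
      by (simp add: u hook_perm_def hook_left_def hook_right_def Let_def del: upt_Suc)
  qed
  ultimately show ?thesis by (intro has_gf_image[OF _ inj_hook_perm])
qed

section \<open>The generating function of the class\<close>

lemma max_split_perms_disjoint:
  assumes "\<And>L R. L @ R \<in> perms \<Longrightarrow> P L R \<Longrightarrow> Q L R \<Longrightarrow> False"
  shows "max_split_perms P \<inter> max_split_perms Q = {}"
proof -
  have False if LR: "L @ R \<in> perms" "P L R" and LR': "L' @ R' \<in> perms" "Q L' R'"
    and eq: "L @ Suc (length (L @ R)) # R = L' @ Suc (length (L' @ R')) # R'" for L R L' R'
  proof -
    have N: "length (L @ R) = length (L' @ R')" using arg_cong[OF eq, of length] by simp
    have "Suc (length (L @ R)) \<notin> set (L @ R)" "Suc (length (L @ R)) \<notin> set (L' @ R')"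
      using perms_lessD[OF LR(1)] perms_lessD[OF LR'(1)] unfolding N by blast+
    then have "L = L' \<and> R = R'" using eq unfolding N by (simp add: append_Cons_eq_iff)
    then show False using assms LR LR' by blast
  qed
  then show ?thesis unfolding max_split_perms_def by blast
qed

lemma perms_cases_max:
  assumes "\<And>L R. L @ R \<in> perms \<Longrightarrow> P (L @ Suc (length (L @ R)) # R) \<longleftrightarrow> Q L R" "P []"
  shows "{p \<in> perms. P p} = {[]} \<union> (\<lambda>q. q @ [Suc (length q)]) ` {q \<in> perms. Q q []} \<union>
    max_split_perms (\<lambda>L R. Q L R \<and> R \<noteq> [])"
proof (intro equalityI subsetI)
  fix p assume p: "p \<in> {p \<in> perms. P p}"
  show "p \<in> {[]} \<union> (\<lambda>q. q @ [Suc (length q)]) ` {q \<in> perms. Q q []} \<union> max_split_perms (\<lambda>L R. Q L R \<and> R \<noteq> [])"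
  proof (cases "p = []")
    case False
    then obtain L R where LR: "p = L @ Suc (length (L @ R)) # R" "L @ R \<in> perms"
      using p perms_max_split by blast
    then have Q: "Q L R" using p assms(1)[OF LR(2)] by simp
    show ?thesis
    proof (cases "R = []")
      case True
      then have "p = (\<lambda>q. q @ [Suc (length q)]) L" "L \<in> {q \<in> perms. Q q []}" using LR Q by simp_all
      then show ?thesis by blast
    next
      case False
      then show ?thesis using LR Q unfolding max_split_perms_def by blast
    qed
  qed simp
next
  fix p assume "p \<in> {[]} \<union> (\<lambda>q. q @ [Suc (length q)]) ` {q \<in> perms. Q q []} \<union> max_split_perms (\<lambda>L R. Q L R \<and> R \<noteq> [])"
  then consider "p = []" | L R where "p = L @ Suc (length (L @ R)) # R" "L @ R \<in> perms" "Q L R"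
    unfolding max_split_perms_def by force
  then show "p \<in> {p \<in> perms. P p}"
  proof cases
    case 2
    then show ?thesis using perms_insert_max[OF refl, of L R] assms(1)[of L R] by simp
  qed (use assms(2) in simp)
qed

lemma has_gf_append_max:
  "has_gf S length f \<Longrightarrow> has_gf ((\<lambda>q. q @ [Suc (length q)]) ` S) length (fps_X ^ 1 * f)"
  by (rule has_gf_image) (auto simp: inj_on_def)

lemma max_split_perms_last: "L @ R \<in> perms \<Longrightarrow> R \<noteq> [] \<Longrightarrow> last (L @ Suc (length (L @ R)) # R) \<noteq> Suc (length (L @ R))"
  using perms_lessD[of "L @ R" "last R"] by auto

lemma cases_max_disjoint:
  "({[]} \<union> (\<lambda>q. q @ [Suc (length q)]) ` S) \<inter> max_split_perms (\<lambda>L R. Q L R \<and> R \<noteq> []) = {}"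
  "{[]} \<inter> (\<lambda>q. q @ [Suc (length q)]) ` S = {}"
proof -
  have "last p \<noteq> length p \<and> p \<noteq> []" if p: "p \<in> max_split_perms (\<lambda>L R. Q L R \<and> R \<noteq> [])" for p
  proof -
    obtain L R where "p = L @ Suc (length (L @ R)) # R" "L @ R \<in> perms" "R \<noteq> []"
      using p unfolding max_split_perms_def by blast
    then show ?thesis using max_split_perms_last[of L R] by simp
  qed
  then show "({[]} \<union> (\<lambda>q. q @ [Suc (length q)]) ` S) \<inter> max_split_perms (\<lambda>L R. Q L R \<and> R \<noteq> []) = {}"
    by fastforce
qed auto

text \<open>Permutations ending in their maximum are kept apart because they lead back to shorter
  ones: for \<open>good\<close> to the class itself, which makes the equation recursive, and for
  \<open>av123\<close> to the decreasing permutations.\<close>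

lemma has_gf_cases_max:
  assumes "\<And>L R. L @ R \<in> perms \<Longrightarrow> P (L @ Suc (length (L @ R)) # R) \<longleftrightarrow> Q L R" "P []"
    and "has_gf {q \<in> perms. Q q []} length f" "has_gf (max_split_perms (\<lambda>L R. Q L R \<and> R \<noteq> [])) length f'"
  shows "has_gf {p \<in> perms. P p} length (1 + fps_X * f + f')"
proof -
  have "has_gf ({[]} \<union> (\<lambda>q. q @ [Suc (length q)]) ` {q \<in> perms. Q q []} \<union> max_split_perms (\<lambda>L R. Q L R \<and> R \<noteq> [])) length
     (fps_X ^ length ([] :: nat list) + fps_X ^ 1 * f + f')"
    by (intro has_gf_Un has_gf_singleton has_gf_append_max assms cases_max_disjoint)
  then show ?thesis using perms_cases_max[of P Q, OF assms(1,2)] by simp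
qed

lemma perms_insert_max_iff:
  assumes "L @ R \<in> perms"
  shows "av123 (L @ Suc (length (L @ R)) # R) \<longleftrightarrow> av123 (L @ R) \<and> dec L"
    and "good (L @ Suc (length (L @ R)) # R) \<longleftrightarrow> good (L @ R) \<and> av123 R \<and>
      (\<forall>a b r. subseq [a, b] L \<longrightarrow> a < b \<longrightarrow> r \<in> set R \<longrightarrow> a < r \<and> r < b)"
proof -
  have d: "distinct (L @ R)" using assms by (simp add: perms_def)
  show "av123 (L @ Suc (length (L @ R)) # R) \<longleftrightarrow> av123 (L @ R) \<and> dec L"
    by (rule av123_insert_max[OF d perms_lessD[OF assms]])
  show "good (L @ Suc (length (L @ R)) # R) \<longleftrightarrow> good (L @ R) \<and> av123 R \<and>
      (\<forall>a b r. subseq [a, b] L \<longrightarrow> a < b \<longrightarrow> r \<in> set R \<longrightarrow> a < r \<and> r < b)"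
    by (rule good_insert_max[OF d perms_lessD[OF assms]])
qed

text \<open>The count is obtained by subtraction from the Catalan series, without describing the
  shape of these permutations.\<close>

lemma has_gf_max_split_av123:
  "has_gf (max_split_perms (\<lambda>L R. av123 (L @ Suc (length (L @ R)) # R) \<and> R \<noteq> [])) length
     (catalan_gf - 1 - fps_X * inverse (1 - fps_X))"
proof -
  let ?V = "max_split_perms (\<lambda>L R. av123 (L @ Suc (length (L @ R)) # R) \<and> R \<noteq> [])"
  have "\<exists>f. has_gf ?V length f"
  proof (rule has_gf_exists)
    fix n
    have "?V \<subseteq> {p \<in> perms. True}"
      unfolding max_split_perms_def using perms_insert_max[OF refl] by blast
    then show "finite {x \<in> ?V. length x = n}"
      using finite_perms_length[of "\<lambda>_. True" n] by (auto elim!: finite_subset[rotated])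
  qed
  then obtain f where f: "has_gf ?V length f" by blast
  have "{q \<in> perms. av123 (q @ Suc (length (q @ [])) # [])} = decreasing"
    using perms_insert_max_iff(1)[of _ "[]"] decreasing_subset_layered
    by (auto simp: decreasing_def layered_def)
  then have "has_gf {q \<in> perms. av123 (q @ Suc (length (q @ [])) # [])} length (inverse (1 - fps_X))"
    using has_gf_decreasing by simp
  then have "has_gf {p \<in> perms. av123 p} length (1 + fps_X * inverse (1 - fps_X) + f)"
    by (rule has_gf_cases_max[OF _ _ _ f, rotated 2]) simp_all
  then have "catalan_gf = 1 + fps_X * inverse (1 - fps_X) + f"
    by (rule has_gf_unique[OF has_gf_av123])
  then have "f = catalan_gf - 1 - fps_X * inverse (1 - fps_X)" by (simp add: algebra_simps)
  then show ?thesis using f by simp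
qed

text \<open>Only the two relations defining \<open>g\<close> and \<open>h\<close> matter, so the
  identity is one of polynomials over any commutative ring.\<close>

lemma rational_part:
  fixes x g h :: "'a :: comm_ring_1"
  assumes g: "(1 - x) * g = 1" and h: "(1 - 2 * x) * h = 1"
  shows "1 - x * g + x * ((h - g * g) * (x * g) + x\<^sup>2 * (g * g) * ((1 - x) * h - g)) +
      x ^ 3 * (g * (h - g) * g + g * (g * (x * g * (x * (g * g) * g))) + g * (((1 - x) * h - g) * (x * g * g))) =
    (1 - 9 * x + 34 * x ^ 2 - 70 * x ^ 3 + 87 * x ^ 4 - 65 * x ^ 5 + 26 * x ^ 6 - 5 * x ^ 7) * (g ^ 6 * h)"
  (is "?E = ?P * _")
proof -
  define u v where "u = 1 - x" and "v = 1 - 2 * x"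
  have ug: "u * g = 1" and vh: "v * h = 1" using g h by (simp_all add: u_def v_def)
  have pw: "u ^ k * g ^ k = 1" for k by (simp add: ug flip: power_mult_distrib)
  have "?E = 1 - x * g + x\<^sup>2 * g * h - x\<^sup>2 * g ^ 3 + x ^ 3 * g * h * (u * g) - x ^ 3 * g ^ 3 +
      x ^ 3 * g\<^sup>2 * h - x ^ 3 * g ^ 3 + x ^ 5 * g ^ 6 + x ^ 4 * g\<^sup>2 * h * (u * g) - x ^ 4 * g ^ 4"
    unfolding u_def by (simp add: algebra_simps power_numeral_reduce)
  \<comment> \<open>Every term is padded with powers of \<open>u * g = 1\<close> and with
    \<open>v * h = 1\<close> to the common factor \<open>g ^ 6 * h\<close>, the highest powers that
    occur.\<close>
  also have "\<dots> = (u ^ 6 * g ^ 6) * (v * h) - x * g * (u ^ 5 * g ^ 5) * (v * h) + x\<^sup>2 * g * h * (u ^ 5 * g ^ 5)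
      - x\<^sup>2 * g ^ 3 * (u ^ 3 * g ^ 3) * (v * h) + x ^ 3 * g * h * (u ^ 5 * g ^ 5) - x ^ 3 * g ^ 3 * (u ^ 3 * g ^ 3) * (v * h)
      + x ^ 3 * g\<^sup>2 * h * (u ^ 4 * g ^ 4) - x ^ 3 * g ^ 3 * (u ^ 3 * g ^ 3) * (v * h) + x ^ 5 * g ^ 6 * (v * h)
      + x ^ 4 * g\<^sup>2 * h * (u ^ 4 * g ^ 4) - x ^ 4 * g ^ 4 * (u\<^sup>2 * g\<^sup>2) * (v * h)"
    unfolding pw ug vh by simp
  also have "\<dots> = (u ^ 6 * v - x * u ^ 5 * v + x\<^sup>2 * u ^ 5 - x\<^sup>2 * u ^ 3 * v + x ^ 3 * u ^ 5 - 2 * x ^ 3 * u ^ 3 * v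
      + x ^ 3 * u ^ 4 + x ^ 5 * v + x ^ 4 * u ^ 4 - x ^ 4 * u\<^sup>2 * v) * (g ^ 6 * h)"
    by (simp add: algebra_simps power_numeral_reduce)
  also have "u ^ 6 * v - x * u ^ 5 * v + x\<^sup>2 * u ^ 5 - x\<^sup>2 * u ^ 3 * v + x ^ 3 * u ^ 5 - 2 * x ^ 3 * u ^ 3 * v
      + x ^ 3 * u ^ 4 + x ^ 5 * v + x ^ 4 * u ^ 4 - x ^ 4 * u\<^sup>2 * v = ?P"
    unfolding u_def v_def by (simp add: algebra_simps power_numeral_reduce)
  finally show ?thesis .
qed

theorem theorem3p17:
  shows "avoidance_gf {[1,2,4,3], [2,3,4,1], [4,1,2,3]} =
    (1 - 9 * fps_X + 34 * fps_X ^ 2 - 70 * fps_X ^ 3 + 87 * fps_X ^ 4 - 65 * fps_X ^ 5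
       + 26 * fps_X ^ 6 - 5 * fps_X ^ 7) / ((1 - fps_X) ^ 7 * (1 - 2 * fps_X))
    + 1 / (1 - fps_X) * (catalan_gf - 1)"
    (is "?F = ?P / _ + _")
proof -
  define g h where "g = inverse (1 - fps_X :: real fps)" and "h = inverse (1 - 2 * fps_X :: real fps)"
  define A B where
    "A = fps_X * ((h - g * g) * (fps_X * g) + fps_X\<^sup>2 * (g * g) * ((1 - fps_X) * h - g))" and
    "B = fps_X ^ 3 * (g * (h - g) * g + g * (g * (fps_X * g * (fps_X * (g * g) * g))) +
       g * (((1 - fps_X) * h - g) * (fps_X * g * g)))"
  have g: "(1 - fps_X) * g = 1" and h: "(1 - 2 * fps_X) * h = 1"
    unfolding g_def h_def by (rule inverse_one_minus_X inverse_one_minus_2X)+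
  let ?G = "\<lambda>L R. good (L @ Suc (length (L @ R)) # R)"
  let ?V = "\<lambda>L R. av123 (L @ Suc (length (L @ R)) # R) \<and> R \<noteq> []"
  let ?S = "\<lambda>L R. ?G L R \<and> R \<noteq> [] \<and> \<not> dec L"
  let ?H = "\<lambda>L R. ?G L R \<and> R \<noteq> [] \<and> dec L \<and> \<not> av123 (L @ Suc (length (L @ R)) # R)"
  \<comment> \<open>Avoiding 123 with the maximum after \<open>L\<close> makes \<open>L\<close>
    decreasing.\<close>
  have VS: "max_split_perms ?V \<inter> max_split_perms ?S = {}"
    by (rule max_split_perms_disjoint) (use perms_insert_max_iff(1) in blast)
  have VSH: "max_split_perms ?V \<inter> max_split_perms ?H = {}" "max_split_perms ?S \<inter> max_split_perms ?H = {}"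
    by (rule max_split_perms_disjoint; blast)+
  have "max_split_perms (\<lambda>L R. ?G L R \<and> R \<noteq> []) = max_split_perms ?V \<union> max_split_perms ?S \<union> max_split_perms ?H"
    using av123_good unfolding max_split_perms_def by blast
  moreover have "has_gf (max_split_perms ?V \<union> max_split_perms ?S \<union> max_split_perms ?H) length
      (catalan_gf - 1 - fps_X * g + A + B)"
  proof (intro has_gf_Un)
    show "has_gf (max_split_perms ?V) length (catalan_gf - 1 - fps_X * g)"
      unfolding g_def by (rule has_gf_max_split_av123)
    show "has_gf (max_split_perms ?S) length A"
      unfolding straddle_perms_eq A_def g_def h_def by (rule has_gf_straddle)
    show "has_gf (max_split_perms ?H) length B"
      unfolding hook_perms_eq B_def g_def h_def by (rule has_gf_hook)
  qed (use VS VSH in blast)+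
  ultimately have rest: "has_gf (max_split_perms (\<lambda>L R. ?G L R \<and> R \<noteq> [])) length (catalan_gf - 1 - fps_X * g + A + B)"
    by simp
  have "{q \<in> perms. ?G q []} = {q \<in> perms. good q}"
    using perms_insert_max_iff(2)[of _ "[]"] by auto
  then have "has_gf {q \<in> perms. ?G q []} length ?F" using avoidance_gf_eq by simp
  then have "has_gf {p \<in> perms. good p} length (1 + fps_X * ?F + (catalan_gf - 1 - fps_X * g + A + B))"
    by (rule has_gf_cases_max[OF _ _ _ rest, rotated 2]) (simp_all add: good_def)
  \<comment> \<open>Both sides count the class, so the decomposition becomes a linear equation for
    its series.\<close>
  then have "?F = 1 + fps_X * ?F + (catalan_gf - 1 - fps_X * g + A + B)"
    by (rule has_gf_unique[OF avoidance_gf_eq])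
  then have F: "(1 - fps_X) * ?F = (catalan_gf - 1) + (1 - fps_X * g + A + B)"
    by (simp add: algebra_simps)
  have rat: "1 - fps_X * g + A + B = ?P * (g ^ 6 * h)"
    unfolding A_def B_def by (rule rational_part[OF g h])
  have "?F = g * ((1 - fps_X) * ?F)" using g by (simp add: mult.commute mult.left_commute flip: mult.assoc)
  also have "\<dots> = ?P * (g ^ 7 * h) + g * (catalan_gf - 1)"
    unfolding F rat by (simp add: algebra_simps power_numeral_reduce)
  also have "?P * (g ^ 7 * h) = ?P / ((1 - fps_X) ^ 7 * (1 - 2 * fps_X))"
    by (simp add: g_def h_def fps_divide_unit fps_inverse_mult fps_inverse_power numeral_fps_const)
  also have "g * (catalan_gf - 1) = 1 / (1 - fps_X) * (catalan_gf - 1)"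
    by (simp add: g_def fps_divide_unit)
  finally show ?thesis .
qed

end
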